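(* Let $(R,\mathfrak m,k)$ be a commutative noetherian local ring. Let $A$ be an artinian $R$-module and $L$ an $\mathfrak m$-torsion $R$-module. Fix an integer $t\geq0$ such that $\mathfrak m^tA=\mathfrak m^{t+1}A$. Then $\operatorname{len}_R(A\otimes_RL)\leq\operatorname{len}_R(A/\mathfrak m^tA)\,\beta^R_0(L)$ and $\operatorname{len}_R(A\otimes_RL)\leq\beta^R_0(A)\,\operatorname{len}_R(L/\mathfrak m^tL)$, with the convention $0\cdot\infty=0$.
   Context: $L$ is $\mathfrak m$-torsion if every element is annihilated by some power of $\mathfrak m$; $\beta^R_0(X)=\operatorname{len}_R(k\otimes_RX)$. *)

theory Defs
  imports "HOL-Algebra.Algebra" "HOL-Library.Extended_Nat"
begin

definition noeth_local_ring :: "('r, 'x) ring_scheme \<Rightarrow> 'r set \<Rightarrow> bool" where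
  "noeth_local_ring R m \<longleftrightarrow> cring R \<and> noetherian_ring R \<and> maximalideal m R \<and>
     (\<forall>I. maximalideal I R \<longrightarrow> I = m)"

text \<open>Powers of an ideal, computed in the monoid of ideals (m^0 = R).\<close>
definition ideal_pow :: "('r, 'x) ring_scheme \<Rightarrow> 'r set \<Rightarrow> nat \<Rightarrow> 'r set" where
  "ideal_pow R I n = I [^]\<^bsub>ideals_set R\<^esub> n"

definition gen_submodule :: "('r, 'x) ring_scheme \<Rightarrow> ('r, 'a, 'c) module_scheme \<Rightarrow> 'a set \<Rightarrow> 'a set" where
  "gen_submodule R M S = \<Inter>{N. submodule N R M \<and> S \<subseteq> N}"

definition ideal_smult :: "('r, 'x) ring_scheme \<Rightarrow> 'r set \<Rightarrow> ('r, 'a, 'c) module_scheme \<Rightarrow> 'a set" where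
  "ideal_smult R I M = gen_submodule R M {a \<odot>\<^bsub>M\<^esub> x | a x. a \<in> I \<and> x \<in> carrier M}"

definition quot_module :: "('r, 'x) ring_scheme \<Rightarrow> ('r, 'a, 'c) module_scheme \<Rightarrow> 'a set \<Rightarrow> ('r, 'a set) module" where
  "quot_module R M N =
    \<lparr> carrier = a_rcosets\<^bsub>M\<^esub> N,
      Group.monoid.mult = (\<lambda>C D. N), Group.monoid.one = N,
      Ring.ring.zero = N,
      Ring.ring.add = set_add M,
      smult = (\<lambda>a C. \<Union>x\<in>C. N +>\<^bsub>M\<^esub> (a \<odot>\<^bsub>M\<^esub> x)) \<rparr>"

definition ring_module :: "('r, 'x) ring_scheme \<Rightarrow> ('r, 'r) module" where
  "ring_module R = \<lparr> carrier = carrier R, Group.monoid.mult = Group.monoid.mult R, Group.monoid.one = Group.monoid.one R,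
                     Ring.ring.zero = Ring.ring.zero R, Ring.ring.add = Ring.ring.add R, smult = Group.monoid.mult R \<rparr>"

definition residue_module :: "('r, 'x) ring_scheme \<Rightarrow> 'r set \<Rightarrow> ('r, 'r set) module" where
  "residue_module R m = quot_module R (ring_module R) m"

definition free_module :: "('r, 'x) ring_scheme \<Rightarrow> 'b set \<Rightarrow> ('r, 'b \<Rightarrow> 'r) module" where
  "free_module R B =
    \<lparr> carrier = {f. (\<forall>x. f x \<in> carrier R) \<and> (\<forall>x. x \<notin> B \<longrightarrow> f x = Ring.ring.zero R) \<and>
                    finite {x. f x \<noteq> Ring.ring.zero R}},
      Group.monoid.mult = (\<lambda>f g x. Ring.ring.zero R), Group.monoid.one = (\<lambda>x. Ring.ring.zero R),
      Ring.ring.zero = (\<lambda>x. Ring.ring.zero R),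
      Ring.ring.add = (\<lambda>f g x. Ring.ring.add R (f x) (g x)),
      smult = (\<lambda>a f x. Group.monoid.mult R a (f x)) \<rparr>"

definition basis_vec :: "('r, 'x) ring_scheme \<Rightarrow> 'b \<Rightarrow> 'b \<Rightarrow> 'r" where
  "basis_vec R p = (\<lambda>q. if q = p then \<one>\<^bsub>R\<^esub> else \<zero>\<^bsub>R\<^esub>)"

definition tensor_relations :: "('r, 'x) ring_scheme \<Rightarrow> ('r, 'a, 'c) module_scheme \<Rightarrow>
    ('r, 'l, 'd) module_scheme \<Rightarrow> ('a \<times> 'l \<Rightarrow> 'r) set" where
  "tensor_relations R A L =
    (let F = free_module R (carrier A \<times> carrier L); e = basis_vec R in
      {e (a \<oplus>\<^bsub>A\<^esub> a', l) \<ominus>\<^bsub>F\<^esub> e (a, l) \<ominus>\<^bsub>F\<^esub> e (a', l) | a a' l.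
          a \<in> carrier A \<and> a' \<in> carrier A \<and> l \<in> carrier L}
    \<union> {e (a, l \<oplus>\<^bsub>L\<^esub> l') \<ominus>\<^bsub>F\<^esub> e (a, l) \<ominus>\<^bsub>F\<^esub> e (a, l') | a l l'.
          a \<in> carrier A \<and> l \<in> carrier L \<and> l' \<in> carrier L}
    \<union> {e (r \<odot>\<^bsub>A\<^esub> a, l) \<ominus>\<^bsub>F\<^esub> (r \<odot>\<^bsub>F\<^esub> e (a, l)) | r a l.
          r \<in> carrier R \<and> a \<in> carrier A \<and> l \<in> carrier L}
    \<union> {e (a, r \<odot>\<^bsub>L\<^esub> l) \<ominus>\<^bsub>F\<^esub> (r \<odot>\<^bsub>F\<^esub> e (a, l)) | r a l.
          r \<in> carrier R \<and> a \<in> carrier A \<and> l \<in> carrier L})"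

definition tensor_module :: "('r, 'x) ring_scheme \<Rightarrow> ('r, 'a, 'c) module_scheme \<Rightarrow>
    ('r, 'l, 'd) module_scheme \<Rightarrow> ('r, ('a \<times> 'l \<Rightarrow> 'r) set) module" where
  "tensor_module R A L =
    quot_module R (free_module R (carrier A \<times> carrier L))
      (gen_submodule R (free_module R (carrier A \<times> carrier L)) (tensor_relations R A L))"

definition mod_length :: "('r, 'x) ring_scheme \<Rightarrow> ('r, 'a, 'c) module_scheme \<Rightarrow> enat" where
  "mod_length R M = Sup {enat n | n. \<exists>N :: nat \<Rightarrow> 'a set.
      (\<forall>i\<le>n. submodule (N i) R M) \<and> (\<forall>i<n. N i \<subset> N (Suc i))}"

definition artinian_module :: "('r, 'x) ring_scheme \<Rightarrow> ('r, 'a, 'c) module_scheme \<Rightarrow> bool" where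
  "artinian_module R M \<longleftrightarrow> module R M \<and>
     \<not> (\<exists>N :: nat \<Rightarrow> 'a set. (\<forall>i. submodule (N i) R M) \<and> (\<forall>i. N (Suc i) \<subset> N i))"

definition torsion_module :: "('r, 'x) ring_scheme \<Rightarrow> 'r set \<Rightarrow> ('r, 'a, 'c) module_scheme \<Rightarrow> bool" where
  "torsion_module R m M \<longleftrightarrow>
     (\<forall>x \<in> carrier M. \<exists>n. \<forall>a \<in> ideal_pow R m n. a \<odot>\<^bsub>M\<^esub> x = \<zero>\<^bsub>M\<^esub>)"

definition beta0 :: "('r, 'x) ring_scheme \<Rightarrow> 'r set \<Rightarrow> ('r, 'a, 'c) module_scheme \<Rightarrow> enat" where
  "beta0 R m M = mod_length R (tensor_module R (residue_module R m) M)"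

end

theory Submission
  imports Defs
begin

text \<open>
  Let \<open>b : U \<times> W \<rightarrow> P\<close> be bilinear with spanning image, and let \<open>S\<close> be a submodule of \<open>U\<close> with
  \<open>m^t U \<subseteq> S\<close> and \<open>b S W = 0\<close>. Then \<open>len P \<le> len (U/S) * beta0 W\<close>: if \<open>U/S\<close> has finite length, choose a
  filtration from \<open>S\<close> to \<open>U\<close> whose steps add one generator \<open>z\<close> with \<open>m z\<close> in the previous term; each
  step contributes to \<open>P\<close> at most the length of an image of \<open>W/m W\<close>. If \<open>U/S\<close> has infinite length,
  only \<open>W = m W\<close> needs an argument, and then \<open>b U W = b (m^t U) W = 0\<close>.

  Since \<open>m^t A = m^(t+1) A\<close> and \<open>L\<close> is torsion, the tensors from \<open>m^t A \<times> L\<close> vanish, hence also those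
  from \<open>A \<times> m^t L\<close>. The two bounds are the cases \<open>(U, W) = (A, L)\<close> and \<open>(U, W) = (L, A)\<close>.
\<close>

section \<open>Submodules and linear maps\<close>

definition linear_map :: "('r, 'x) ring_scheme \<Rightarrow> ('r, 'a, 'c) module_scheme \<Rightarrow>
    ('r, 'b, 'd) module_scheme \<Rightarrow> ('a \<Rightarrow> 'b) \<Rightarrow> bool" where
  "linear_map R M N f \<longleftrightarrow> f \<in> carrier M \<rightarrow> carrier N \<and>
     (\<forall>x\<in>carrier M. \<forall>y\<in>carrier M. f (x \<oplus>\<^bsub>M\<^esub> y) = f x \<oplus>\<^bsub>N\<^esub> f y) \<and>
     (\<forall>a\<in>carrier R. \<forall>x\<in>carrier M. f (a \<odot>\<^bsub>M\<^esub> x) = a \<odot>\<^bsub>N\<^esub> f x)"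

lemma linear_mapD:
  assumes "linear_map R M N f"
  shows "x \<in> carrier M \<Longrightarrow> f x \<in> carrier N"
    and "\<lbrakk>x \<in> carrier M; y \<in> carrier M\<rbrakk> \<Longrightarrow> f (x \<oplus>\<^bsub>M\<^esub> y) = f x \<oplus>\<^bsub>N\<^esub> f y"
    and "\<lbrakk>a \<in> carrier R; x \<in> carrier M\<rbrakk> \<Longrightarrow> f (a \<odot>\<^bsub>M\<^esub> x) = a \<odot>\<^bsub>N\<^esub> f x"
  using assms by (auto simp: linear_map_def)

context module
begin

lemma minus_eq_smult: "x \<in> carrier M \<Longrightarrow> \<ominus>\<^bsub>M\<^esub> x = (\<ominus> \<one>) \<odot>\<^bsub>M\<^esub> x"
  by (simp add: smult_l_minus)

text \<open>Negation is the action of \<open>\<ominus> \<one>\<close>, so closure under it follows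
  from closure under scalars and need not be checked in each application.\<close>

lemma submodule_of_closed:
  assumes "H \<subseteq> carrier M" "\<zero>\<^bsub>M\<^esub> \<in> H"
    and "\<And>x y. \<lbrakk>x \<in> H; y \<in> H\<rbrakk> \<Longrightarrow> x \<oplus>\<^bsub>M\<^esub> y \<in> H"
    and smult: "\<And>a x. \<lbrakk>a \<in> carrier R; x \<in> H\<rbrakk> \<Longrightarrow> a \<odot>\<^bsub>M\<^esub> x \<in> H"
  shows "submodule H R M"
proof (rule submoduleI)
  fix x assume "x \<in> H"
  then show "\<ominus>\<^bsub>M\<^esub> x \<in> H"
    using smult[of "\<ominus> \<one>" x] assms(1) by (auto simp: minus_eq_smult)
qed (use assms in auto)

lemma submodule_zero_mem: "submodule H R M \<Longrightarrow> \<zero>\<^bsub>M\<^esub> \<in> H"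
  using subgroup.one_closed[OF submodule.axioms(1)] by fastforce

lemma submodule_diff_mem:
  "\<lbrakk>submodule H R M; x \<in> H; y \<in> H\<rbrakk> \<Longrightarrow> x \<ominus>\<^bsub>M\<^esub> y \<in> H"
  by (simp add: a_minus_def submoduleE)

lemma zero_submodule: "submodule {\<zero>\<^bsub>M\<^esub>} R M"
  by (rule submodule_of_closed) auto

lemma submodule_Inter:
  assumes "F \<noteq> {}" "\<And>N. N \<in> F \<Longrightarrow> submodule N R M"
  shows "submodule (\<Inter>F) R M"
proof (rule submodule_of_closed)
  show "\<Inter>F \<subseteq> carrier M"
    using assms submoduleE(1) by blast
qed (use assms in \<open>auto simp: submoduleE submodule_zero_mem\<close>)

lemma gen_submodule_submodule:
  assumes "S \<subseteq> carrier M"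
  shows "submodule (gen_submodule R M S) R M"
  unfolding gen_submodule_def
  by (rule submodule_Inter) (use assms carrier_is_submodule in auto)

lemma gen_submodule_incl: "S \<subseteq> gen_submodule R M S"
  by (auto simp: gen_submodule_def)

lemma gen_submodule_minimal:
  "\<lbrakk>submodule N R M; S \<subseteq> N\<rbrakk> \<Longrightarrow> gen_submodule R M S \<subseteq> N"
  by (auto simp: gen_submodule_def)

lemma ideal_smult_submodule:
  assumes "I \<subseteq> carrier R"
  shows "submodule (ideal_smult R I M) R M"
  unfolding ideal_smult_def by (rule gen_submodule_submodule) (use assms in auto)

lemma ideal_smult_mem:
  "\<lbrakk>a \<in> I; x \<in> carrier M\<rbrakk> \<Longrightarrow> a \<odot>\<^bsub>M\<^esub> x \<in> ideal_smult R I M"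
  unfolding ideal_smult_def using gen_submodule_incl by fastforce

lemma ideal_smult_minimal:
  assumes "submodule N R M" "\<And>a x. \<lbrakk>a \<in> I; x \<in> carrier M\<rbrakk> \<Longrightarrow> a \<odot>\<^bsub>M\<^esub> x \<in> N"
  shows "ideal_smult R I M \<subseteq> N"
  unfolding ideal_smult_def by (rule gen_submodule_minimal) (use assms in auto)

lemma submodule_sum:
  assumes H: "submodule H R M" and K: "submodule K R M"
  shows "submodule (H <+>\<^bsub>M\<^esub> K) R M"
proof (rule submodule_of_closed)
  have HM: "H \<subseteq> carrier M" and KM: "K \<subseteq> carrier M"
    using H K submoduleE(1) by blast+
  then show "H <+>\<^bsub>M\<^esub> K \<subseteq> carrier M"
    by (auto simp: set_add_def')
  show "\<zero>\<^bsub>M\<^esub> \<in> H <+>\<^bsub>M\<^esub> K"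
    using submodule_zero_mem[OF H] submodule_zero_mem[OF K] M.r_zero[of "\<zero>\<^bsub>M\<^esub>"]
    unfolding set_add_def' by force
  fix x y assume "x \<in> H <+>\<^bsub>M\<^esub> K" "y \<in> H <+>\<^bsub>M\<^esub> K"
  then obtain h k h' k' where *: "h \<in> H" "k \<in> K" "h' \<in> H" "k' \<in> K"
    "x = h \<oplus>\<^bsub>M\<^esub> k" "y = h' \<oplus>\<^bsub>M\<^esub> k'"
    by (auto simp: set_add_def')
  have "x \<oplus>\<^bsub>M\<^esub> y = (h \<oplus>\<^bsub>M\<^esub> h') \<oplus>\<^bsub>M\<^esub> (k \<oplus>\<^bsub>M\<^esub> k')"
    using * HM KM by (simp add: subset_iff M.a_ac)
  moreover have "h \<oplus>\<^bsub>M\<^esub> h' \<in> H" "k \<oplus>\<^bsub>M\<^esub> k' \<in> K"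
    using * H K by (auto simp: submoduleE)
  ultimately show "x \<oplus>\<^bsub>M\<^esub> y \<in> H <+>\<^bsub>M\<^esub> K"
    by (auto simp: set_add_def')
next
  have HM: "H \<subseteq> carrier M" and KM: "K \<subseteq> carrier M"
    using H K submoduleE(1) by blast+
  fix a x assume a: "a \<in> carrier R" and "x \<in> H <+>\<^bsub>M\<^esub> K"
  then obtain h k where *: "h \<in> H" "k \<in> K" "x = h \<oplus>\<^bsub>M\<^esub> k"
    by (auto simp: set_add_def')
  have "a \<odot>\<^bsub>M\<^esub> x = a \<odot>\<^bsub>M\<^esub> h \<oplus>\<^bsub>M\<^esub> a \<odot>\<^bsub>M\<^esub> k"
    using * a HM KM by (simp add: subset_iff smult_r_distr)
  moreover have "a \<odot>\<^bsub>M\<^esub> h \<in> H" "a \<odot>\<^bsub>M\<^esub> k \<in> K"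
    using * a H K by (auto simp: submoduleE)
  ultimately show "a \<odot>\<^bsub>M\<^esub> x \<in> H <+>\<^bsub>M\<^esub> K"
    by (auto simp: set_add_def')
qed

lemma submodule_sum_upper:
  assumes "submodule H R M" "submodule K R M"
  shows "H \<subseteq> H <+>\<^bsub>M\<^esub> K" "K \<subseteq> H <+>\<^bsub>M\<^esub> K"
proof -
  show "H \<subseteq> H <+>\<^bsub>M\<^esub> K"
  proof
    fix h assume "h \<in> H"
    moreover then have "h = h \<oplus>\<^bsub>M\<^esub> \<zero>\<^bsub>M\<^esub>"
      using submoduleE(1)[OF assms(1)] by auto
    ultimately show "h \<in> H <+>\<^bsub>M\<^esub> K"
      using submodule_zero_mem[OF assms(2)] unfolding set_add_def' by blast
  qed
  show "K \<subseteq> H <+>\<^bsub>M\<^esub> K"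
  proof
    fix k assume "k \<in> K"
    moreover then have "k = \<zero>\<^bsub>M\<^esub> \<oplus>\<^bsub>M\<^esub> k"
      using submoduleE(1)[OF assms(2)] by auto
    ultimately show "k \<in> H <+>\<^bsub>M\<^esub> K"
      using submodule_zero_mem[OF assms(1)] unfolding set_add_def' by blast
  qed
qed

end

section \<open>Zero, differences, preimages and images under a linear map\<close>

context
  fixes R :: "('r, 'x) ring_scheme"
    and M :: "('r, 'a, 'c) module_scheme" and N :: "('r, 'b, 'd) module_scheme"
    and f :: "'a \<Rightarrow> 'b"
  assumes M: "module R M" and N: "module R N" and f: "linear_map R M N f"
begin

interpretation M: module R M by (rule M)
interpretation N: module R N by (rule N)

lemma linear_map_zero: "f \<zero>\<^bsub>M\<^esub> = \<zero>\<^bsub>N\<^esub>"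
  using linear_mapD(3)[OF f, of "\<zero>\<^bsub>R\<^esub>" "\<zero>\<^bsub>M\<^esub>"] linear_mapD(1)[OF f, of "\<zero>\<^bsub>M\<^esub>"] by simp

lemma linear_map_diff:
  assumes "x \<in> carrier M" "y \<in> carrier M"
  shows "f (x \<ominus>\<^bsub>M\<^esub> y) = f x \<ominus>\<^bsub>N\<^esub> f y"
  using assms linear_mapD[OF f]
  by (simp add: a_minus_def M.minus_eq_smult N.minus_eq_smult)

lemma submodule_vimage:
  assumes V: "submodule V R N"
  shows "submodule {x \<in> carrier M. f x \<in> V} R M"
  by (rule M.submodule_of_closed)
    (use V linear_mapD[OF f] linear_map_zero in \<open>auto simp: N.submoduleE N.submodule_zero_mem\<close>)

lemma submodule_image:
  assumes S: "submodule S R M"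
  shows "submodule (f ` S) R N"
proof (rule N.submodule_of_closed)
  have SM: "S \<subseteq> carrier M"
    using S M.submoduleE(1) by blast
  then show "f ` S \<subseteq> carrier N"
    using linear_mapD(1)[OF f] by blast
  show "\<zero>\<^bsub>N\<^esub> \<in> f ` S"
    using linear_map_zero M.submodule_zero_mem[OF S] by (metis imageI)
  show "x \<oplus>\<^bsub>N\<^esub> y \<in> f ` S" if xy: "x \<in> f ` S" "y \<in> f ` S" for x y
  proof -
    obtain u v where "u \<in> S" "v \<in> S" "x = f u" "y = f v"
      using xy by blast
    then have "x \<oplus>\<^bsub>N\<^esub> y = f (u \<oplus>\<^bsub>M\<^esub> v)" "u \<oplus>\<^bsub>M\<^esub> v \<in> S"
      using SM S linear_mapD(2)[OF f] by (auto simp: subset_iff M.submoduleE)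
    then show ?thesis by blast
  qed
  show "a \<odot>\<^bsub>N\<^esub> x \<in> f ` S" if a: "a \<in> carrier R" and x: "x \<in> f ` S" for a x
  proof -
    obtain u where "u \<in> S" "x = f u"
      using x by blast
    then have "a \<odot>\<^bsub>N\<^esub> x = f (a \<odot>\<^bsub>M\<^esub> u)" "a \<odot>\<^bsub>M\<^esub> u \<in> S"
      using SM S a linear_mapD(3)[OF f] by (auto simp: subset_iff M.submoduleE)
    then show ?thesis by blast
  qed
qed

end

section \<open>Quotient modules\<close>

locale module_quotient = module R M for R :: "('r, 'x) ring_scheme" and M :: "('r, 'a, 'c) module_scheme" +
  fixes K :: "'a set"
  assumes K: "submodule K R M"
begin

abbreviation Q where "Q \<equiv> quot_module R M K"

definition proj where "proj x = K +>\<^bsub>M\<^esub> x"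

sublocale K: abelian_subgroup K M
  by (rule abelian_subgroupI3)
    (use submodule.axioms(1)[OF K] in \<open>auto intro: additive_subgroup.intro abelian_group_axioms\<close>)

lemma carrier_Q: "carrier Q = proj ` carrier M"
  by (auto simp: quot_module_def A_RCOSETS_def' proj_def)

lemma proj_add:
  "\<lbrakk>x \<in> carrier M; y \<in> carrier M\<rbrakk> \<Longrightarrow> proj x \<oplus>\<^bsub>Q\<^esub> proj y = proj (x \<oplus>\<^bsub>M\<^esub> y)"
  by (simp add: quot_module_def proj_def K.a_rcos_sum)

lemma zero_Q: "\<zero>\<^bsub>Q\<^esub> = proj \<zero>\<^bsub>M\<^esub>"
  using submoduleE(1)[OF K] by (simp add: quot_module_def proj_def)

lemma proj_eq_iff:
  assumes "x \<in> carrier M" "y \<in> carrier M"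
  shows "proj x = proj y \<longleftrightarrow> x \<ominus>\<^bsub>M\<^esub> y \<in> K"
proof
  assume "proj x = proj y"
  then have "x \<in> K +>\<^bsub>M\<^esub> y"
    using assms(1) K.a_rcos_self by (metis proj_def)
  then show "x \<ominus>\<^bsub>M\<^esub> y \<in> K"
    using assms K.a_rcos_module by (simp add: a_minus_def)
next
  assume "x \<ominus>\<^bsub>M\<^esub> y \<in> K"
  then have "x \<in> K +>\<^bsub>M\<^esub> y"
    using assms K.a_rcos_module by (simp add: a_minus_def)
  then show "proj x = proj y"
    using assms K.a_repr_independence' by (metis proj_def)
qed

text \<open>The scalar action on \<open>Q\<close> is a union over all members of a coset. Two
  members differ by an element of \<open>K\<close>, hence so do their multiples, and all cosets in
  the union coincide. The union is not empty, since \<open>x\<close> itself is one of its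
  indices.\<close>

lemma proj_smult:
  assumes a: "a \<in> carrier R" and x: "x \<in> carrier M"
  shows "a \<odot>\<^bsub>Q\<^esub> proj x = proj (a \<odot>\<^bsub>M\<^esub> x)"
proof -
  have "K +>\<^bsub>M\<^esub> (a \<odot>\<^bsub>M\<^esub> z) = proj (a \<odot>\<^bsub>M\<^esub> x)" if z: "z \<in> proj x" for z
  proof -
    have zM: "z \<in> carrier M"
      using z x submoduleE(1)[OF K] M.a_r_coset_subset_G unfolding proj_def by blast
    have "proj x = proj z"
      using z x K.a_repr_independence' unfolding proj_def by blast
    then have "z \<ominus>\<^bsub>M\<^esub> x \<in> K"
      using proj_eq_iff x zM by metis
    then have "a \<odot>\<^bsub>M\<^esub> (z \<ominus>\<^bsub>M\<^esub> x) \<in> K"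
      using K a submoduleE(4) by blast
    then have "a \<odot>\<^bsub>M\<^esub> z \<ominus>\<^bsub>M\<^esub> a \<odot>\<^bsub>M\<^esub> x \<in> K"
      using a x zM by (simp add: a_minus_def smult_r_distr smult_r_minus)
    then show ?thesis
      using proj_eq_iff a x zM by (simp add: proj_def)
  qed
  moreover have "x \<in> proj x"
    using x K.a_rcos_self by (simp add: proj_def)
  ultimately show ?thesis
    by (auto simp: quot_module_def)
qed

lemma module_Q: "module R Q"
proof (rule moduleI)
  show "cring R" by (rule R.is_cring)
  show "abelian_group Q"
  proof (rule abelian_groupI)
    fix x assume "x \<in> carrier Q"
    then obtain u where "u \<in> carrier M" "x = proj u"
      by (auto simp: carrier_Q)
    then show "\<exists>y\<in>carrier Q. y \<oplus>\<^bsub>Q\<^esub> x = \<zero>\<^bsub>Q\<^esub>"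
      by (intro bexI[of _ "proj (\<ominus>\<^bsub>M\<^esub> u)"]) (auto simp: carrier_Q proj_add zero_Q M.l_neg)
  qed (auto simp: carrier_Q proj_add zero_Q M.a_ac)
qed (auto simp: carrier_Q proj_add proj_smult R.add.m_closed smult_l_distr smult_r_distr smult_assoc1)

lemma proj_linear: "linear_map R M Q proj"
  by (auto simp: linear_map_def carrier_Q proj_add proj_smult)

lemma proj_image_submodule: "submodule N R M \<Longrightarrow> submodule (proj ` N) R Q"
  by (rule submodule_image[OF module_axioms module_Q proj_linear])

text \<open>The condition \<open>K \<subseteq> N\<close> makes \<open>N\<close> a union of cosets of
  \<open>K\<close>. This is the injectivity half of the correspondence between submodules above
  \<open>K\<close> and submodules of the quotient; it keeps strict inclusions strict after
  projection.\<close>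

lemma proj_mem_image_iff:
  assumes N: "submodule N R M" "K \<subseteq> N" and x: "x \<in> carrier M"
  shows "proj x \<in> proj ` N \<longleftrightarrow> x \<in> N"
proof
  assume "proj x \<in> proj ` N"
  then obtain y where y: "y \<in> N" "proj x = proj y" by blast
  have yM: "y \<in> carrier M" using y submoduleE(1)[OF N(1)] by blast
  have "x \<ominus>\<^bsub>M\<^esub> y \<in> N"
    using y proj_eq_iff[OF x yM] N(2) by blast
  then have "(x \<ominus>\<^bsub>M\<^esub> y) \<oplus>\<^bsub>M\<^esub> y \<in> N"
    using y N submoduleE(5) by blast
  then show "x \<in> N"
    using x yM by (simp add: a_minus_def M.a_assoc M.l_neg)
qed auto

end

section \<open>Length\<close>

text \<open>Deleting repetitions from a weakly increasing chain leaves one strict inclusion for each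
  strict step. The clause that the last term equals \<open>S n\<close> is what allows the induction
  to append \<open>S (Suc n)\<close>.\<close>

lemma strict_subchain:
  fixes S :: "nat \<Rightarrow> 'a set"
  assumes "\<And>i. i < n \<Longrightarrow> S i \<subseteq> S (Suc i)"
  shows "\<exists>T. (\<forall>i \<le> card {i. i < n \<and> S i \<noteq> S (Suc i)}. T i \<in> S ` {..n}) \<and>
    (\<forall>i < card {i. i < n \<and> S i \<noteq> S (Suc i)}. T i \<subset> T (Suc i)) \<and>
    T (card {i. i < n \<and> S i \<noteq> S (Suc i)}) = S n"
  using assms
proof (induction n)
  case 0
  then show ?case by (intro exI[of _ S]) auto
next
  case (Suc n)
  let ?k = "card {i. i < n \<and> S i \<noteq> S (Suc i)}"
  obtain T where T: "\<And>i. i \<le> ?k \<Longrightarrow> T i \<in> S ` {..n}" "\<And>i. i < ?k \<Longrightarrow> T i \<subset> T (Suc i)" "T ?k = S n"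
    using Suc.IH[OF Suc.prems[OF less_SucI]] by blast
  show ?case
  proof (cases "S n = S (Suc n)")
    case True
    then have "{i. i < Suc n \<and> S i \<noteq> S (Suc i)} = {i. i < n \<and> S i \<noteq> S (Suc i)}"
      by (auto simp: less_Suc_eq)
    then show ?thesis
      unfolding True[symmetric] using T by (intro exI[of _ T]) (simp add: atMost_Suc)
  next
    case False
    then have "{i. i < Suc n \<and> S i \<noteq> S (Suc i)} = insert n {i. i < n \<and> S i \<noteq> S (Suc i)}"
      by (auto simp: less_Suc_eq)
    then have k: "card {i. i < Suc n \<and> S i \<noteq> S (Suc i)} = Suc ?k"
      by simp
    have "S n \<subset> S (Suc n)"
      using False Suc.prems[of n] by auto
    then show ?thesis
      unfolding k using T
      by (intro exI[of _ "T(Suc ?k := S (Suc n))"]) (auto simp: atMost_Suc le_Suc_eq less_Suc_eq)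
  qed
qed

lemma mod_length_ge:
  assumes "\<And>i. i \<le> n \<Longrightarrow> submodule (N i) R M" "\<And>i. i < n \<Longrightarrow> N i \<subset> N (Suc i)"
  shows "enat n \<le> mod_length R M"
  unfolding mod_length_def using assms by (intro Sup_upper) blast

lemma mod_length_le:
  assumes "\<And>n N. \<lbrakk>\<And>i. i \<le> n \<Longrightarrow> submodule (N i) R M; \<And>i. i < n \<Longrightarrow> N i \<subset> N (Suc i)\<rbrakk> \<Longrightarrow> enat n \<le> b"
  shows "mod_length R M \<le> b"
  unfolding mod_length_def using assms by (intro Sup_least) blast

text \<open>Chains with repetitions are allowed because chains obtained as preimages need not be
  strict. The repetitions are deleted first, and the strict inclusions that remain survive
  projection since every term contains \<open>K\<close>.\<close>

lemma (in module_quotient) mod_length_Q_ge: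
  assumes N: "\<And>i. i \<le> n \<Longrightarrow> submodule (N i) R M" "\<And>i. i \<le> n \<Longrightarrow> K \<subseteq> N i"
    and mono: "\<And>i. i < n \<Longrightarrow> N i \<subseteq> N (Suc i)"
  shows "enat (card {i. i < n \<and> N i \<noteq> N (Suc i)}) \<le> mod_length R Q"
proof -
  let ?k = "card {i. i < n \<and> N i \<noteq> N (Suc i)}"
  obtain T where T: "\<And>i. i \<le> ?k \<Longrightarrow> T i \<in> N ` {..n}" "\<And>i. i < ?k \<Longrightarrow> T i \<subset> T (Suc i)"
    using strict_subchain[of n N] mono by blast
  have sub: "submodule (T i) R M" "K \<subseteq> T i" if "i \<le> ?k" for i
    using T(1)[OF that] N by auto
  show ?thesis
  proof (rule mod_length_ge[where N = "\<lambda>i. proj ` T i"])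
    show "submodule (proj ` T i) R Q" if "i \<le> ?k" for i
      using sub that proj_image_submodule by blast
    show "proj ` T i \<subset> proj ` T (Suc i)" if i: "i < ?k" for i
    proof -
      obtain x where x: "x \<in> T (Suc i)" "x \<notin> T i"
        using T(2)[OF i] by blast
      then have "x \<in> carrier M"
        using sub(1)[of "Suc i"] submoduleE(1) i by fastforce
      then have "proj x \<notin> proj ` T i"
        using proj_mem_image_iff[OF sub(1) sub(2)] x i by simp
      then show ?thesis
        using T(2)[OF i] x by blast
    qed
  qed
qed

section \<open>Free modules\<close>

context cring
begin

lemma free_module_module: "module R (free_module R B)"
proof (rule moduleI)
  let ?F = "free_module R B"
  show "cring R" by (rule is_cring)
  have add: "finite {x. f x \<oplus> g x \<noteq> \<zero>}" if "f \<in> carrier ?F" "g \<in> carrier ?F" for f g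
  proof -
    have "finite {x. f x \<noteq> \<zero>}" "finite {x. g x \<noteq> \<zero>}"
      using that by (auto simp: free_module_def)
    moreover have "{x. f x \<oplus> g x \<noteq> \<zero>} \<subseteq> {x. f x \<noteq> \<zero>} \<union> {x. g x \<noteq> \<zero>}"
      by auto
    ultimately show ?thesis
      by (meson finite_UnI finite_subset)
  qed
  have smult: "finite {x. a \<otimes> f x \<noteq> \<zero>}" if "a \<in> carrier R" "f \<in> carrier ?F" for a f
  proof -
    have "finite {x. f x \<noteq> \<zero>}"
      using that by (auto simp: free_module_def)
    moreover have "{x. a \<otimes> f x \<noteq> \<zero>} \<subseteq> {x. f x \<noteq> \<zero>}"
      using that by auto
    ultimately show ?thesis
      by (rule rev_finite_subset)
  qed
  show "abelian_group ?F"
  proof (rule abelian_groupI)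
    fix f g assume "f \<in> carrier ?F" "g \<in> carrier ?F"
    then show "f \<oplus>\<^bsub>?F\<^esub> g \<in> carrier ?F"
      using add[of f g] by (simp add: free_module_def)
  next
    fix f assume f: "f \<in> carrier ?F"
    \<comment> \<open>The negative is written as a multiple by \<open>\<ominus> \<one>\<close>, so
      that its finite support is an instance of \<open>smult\<close>.\<close>
    have "(\<lambda>x. \<ominus> \<one> \<otimes> f x) \<in> carrier ?F"
      using f smult[of "\<ominus> \<one>" f] by (simp add: free_module_def)
    moreover have "(\<lambda>x. \<ominus> \<one> \<otimes> f x \<oplus> f x) = (\<lambda>x. \<zero>)"
      using f by (simp add: free_module_def l_minus l_neg)
    ultimately show "\<exists>g\<in>carrier ?F. g \<oplus>\<^bsub>?F\<^esub> f = \<zero>\<^bsub>?F\<^esub>"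
      by (intro bexI[of _ "\<lambda>x. \<ominus> \<one> \<otimes> f x"]) (simp_all add: free_module_def)
  qed (simp_all add: free_module_def a_ac)
  show "a \<odot>\<^bsub>?F\<^esub> f \<in> carrier ?F" if "a \<in> carrier R" "f \<in> carrier ?F" for a f
    using that smult[of a f] by (simp add: free_module_def)
qed (simp_all add: free_module_def l_distr r_distr m_assoc)

lemma basis_vec_carrier: "p \<in> B \<Longrightarrow> basis_vec R p \<in> carrier (free_module R B)"
proof -
  assume "p \<in> B"
  moreover have "finite {x. basis_vec R p x \<noteq> \<zero>}"
    by (rule finite_subset[of _ "{p}"]) (auto simp: basis_vec_def)
  ultimately show ?thesis
    by (auto simp: free_module_def basis_vec_def)
qed

text \<open>Induction over a finite set containing the support: clearing the coefficient at one
  index shrinks that set, and the part removed is a multiple of a basis vector.\<close>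

lemma free_module_span:
  assumes N: "submodule N R (free_module R B)" and e: "\<And>p. p \<in> B \<Longrightarrow> basis_vec R p \<in> N"
  shows "N = carrier (free_module R B)"
proof -
  let ?F = "free_module R B"
  interpret F: module R ?F by (rule free_module_module)
  have "f \<in> N" if "finite S" "f \<in> carrier ?F" "{x. f x \<noteq> \<zero>} \<subseteq> S" for S f
    using that
  proof (induction S arbitrary: f rule: finite_induct)
    case empty
    then have "f = \<zero>\<^bsub>?F\<^esub>"
      by (auto simp: free_module_def)
    then show ?case
      using F.submodule_zero_mem[OF N] by simp
  next
    case (insert p S)
    have fin: "finite {x. x \<noteq> p \<and> f x \<noteq> \<zero>}"
      using insert by (auto intro: finite_subset[of _ "insert p S"])
    have "f(p := \<zero>) \<in> N"
      using insert.prems fin by (intro insert.IH) (auto simp: free_module_def if_distrib cong: conj_cong)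
    moreover have "f p \<odot>\<^bsub>?F\<^esub> basis_vec R p \<in> N" if "p \<in> B"
      using that insert.prems F.submoduleE(4)[OF N] e by (simp add: free_module_def)
    moreover have "f = f(p := \<zero>) \<oplus>\<^bsub>?F\<^esub> f p \<odot>\<^bsub>?F\<^esub> basis_vec R p"
      using insert.prems by (auto simp: free_module_def basis_vec_def)
    \<comment> \<open>Outside \<open>B\<close> no basis vector is available, but there the
      coefficient is zero already.\<close>
    moreover have "f = f(p := \<zero>)" if "p \<notin> B"
      using that insert.prems by (auto simp: free_module_def)
    ultimately show ?case
      using F.submoduleE(5)[OF N] by metis
  qed
  then have "carrier ?F \<subseteq> N"
    by (auto simp: free_module_def)
  then show ?thesis
    using F.submoduleE(1)[OF N] by blast
qed

end

text \<open>The linear extension of \<open>g\<close> from the basis vectors. The sum is restricted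
  to the support of \<open>f\<close>, which is finite on the free module; a \<open>finsum\<close>
  over an infinite index set would be zero by default.\<close>

definition free_lift :: "('r, 'x) ring_scheme \<Rightarrow> ('r, 'a, 'c) module_scheme \<Rightarrow> ('b \<Rightarrow> 'a) \<Rightarrow> ('b \<Rightarrow> 'r) \<Rightarrow> 'a" where
  "free_lift R M g f = (\<Oplus>\<^bsub>M\<^esub>p \<in> {p. f p \<noteq> \<zero>\<^bsub>R\<^esub>}. f p \<odot>\<^bsub>M\<^esub> g p)"

context module
begin

context
  fixes B :: "'e set" and g :: "'e \<Rightarrow> 'c"
  assumes g: "g \<in> B \<rightarrow> carrier M"
begin

text \<open>Enlarging the support adds only zero terms. This provides a common finite index set for
  comparing the lifts of two functions with the lift of their sum.\<close>

lemma free_lift_eq: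
  assumes f: "f \<in> carrier (free_module R B)" and S: "finite S" "{p. f p \<noteq> \<zero>} \<subseteq> S" "S \<subseteq> B"
  shows "free_lift R M g f = (\<Oplus>\<^bsub>M\<^esub>p \<in> S. f p \<odot>\<^bsub>M\<^esub> g p)"
  unfolding free_lift_def
  by (rule M.add.finprod_mono_neutral_cong_left) (use f S g in \<open>auto simp: free_module_def Pi_iff subset_iff\<close>)

lemma free_lift_linear: "linear_map R (free_module R B) M (free_lift R M g)"
proof -
  let ?F = "free_module R B"
  interpret F: module R ?F by (rule free_module_module)
  have supp: "finite {p. f p \<noteq> \<zero>}" "{p. f p \<noteq> \<zero>} \<subseteq> B" "\<And>p. f p \<in> carrier R"
    if "f \<in> carrier ?F" for f
    using that by (auto simp: free_module_def)
  have summand: "(\<lambda>p. f p \<odot>\<^bsub>M\<^esub> g p) \<in> S \<rightarrow> carrier M" if "f \<in> carrier ?F" "S \<subseteq> B" for f S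
    using that g supp(3) by blast
  show ?thesis
    unfolding linear_map_def
  proof (intro conjI ballI funcsetI)
    fix f assume f: "f \<in> carrier ?F"
    then show "free_lift R M g f \<in> carrier M"
      unfolding free_lift_def using supp summand by (intro M.finsum_closed) blast
    fix a assume a: "a \<in> carrier R"
    let ?S = "{p. f p \<noteq> \<zero>}"
    have af: "a \<odot>\<^bsub>?F\<^esub> f \<in> carrier ?F"
      using a f by simp
    have "free_lift R M g (a \<odot>\<^bsub>?F\<^esub> f) = (\<Oplus>\<^bsub>M\<^esub>p \<in> ?S. (a \<odot>\<^bsub>?F\<^esub> f) p \<odot>\<^bsub>M\<^esub> g p)"
      by (rule free_lift_eq[OF af]) (use supp[OF f] a in \<open>auto simp: free_module_def\<close>)
    also have "\<dots> = (\<Oplus>\<^bsub>M\<^esub>p \<in> ?S. a \<odot>\<^bsub>M\<^esub> (f p \<odot>\<^bsub>M\<^esub> g p))"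
      by (rule M.finsum_cong') (use supp[OF f] a g in \<open>auto simp: free_module_def smult_assoc1 Pi_iff subset_iff\<close>)
    also have "\<dots> = a \<odot>\<^bsub>M\<^esub> free_lift R M g f"
      unfolding free_lift_def using finsum_smult_ldistr[OF _ a summand[OF f]] supp[OF f] by simp
    finally show "free_lift R M g (a \<odot>\<^bsub>?F\<^esub> f) = a \<odot>\<^bsub>M\<^esub> free_lift R M g f" .
  next
    fix f h assume f: "f \<in> carrier ?F" and h: "h \<in> carrier ?F"
    let ?S = "{p. f p \<noteq> \<zero>} \<union> {p. h p \<noteq> \<zero>}"
    have S: "finite ?S" "?S \<subseteq> B"
      using supp f h by auto
    have fh: "f \<oplus>\<^bsub>?F\<^esub> h \<in> carrier ?F"
      using f h by simp
    have "free_lift R M g (f \<oplus>\<^bsub>?F\<^esub> h) = (\<Oplus>\<^bsub>M\<^esub>p \<in> ?S. (f \<oplus>\<^bsub>?F\<^esub> h) p \<odot>\<^bsub>M\<^esub> g p)"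
      by (rule free_lift_eq[OF fh S(1) _ S(2)]) (auto simp: free_module_def)
    also have "\<dots> = (\<Oplus>\<^bsub>M\<^esub>p \<in> ?S. f p \<odot>\<^bsub>M\<^esub> g p \<oplus>\<^bsub>M\<^esub> h p \<odot>\<^bsub>M\<^esub> g p)"
      by (rule M.finsum_cong')
        (use supp[OF f] supp[OF h] S g in \<open>auto simp: free_module_def smult_l_distr Pi_iff subset_iff\<close>)
    also have "\<dots> = (\<Oplus>\<^bsub>M\<^esub>p \<in> ?S. f p \<odot>\<^bsub>M\<^esub> g p) \<oplus>\<^bsub>M\<^esub> (\<Oplus>\<^bsub>M\<^esub>p \<in> ?S. h p \<odot>\<^bsub>M\<^esub> g p)"
      by (rule M.finsum_addf) (use summand S f h in blast)+
    also have "\<dots> = free_lift R M g f \<oplus>\<^bsub>M\<^esub> free_lift R M g h"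
      using free_lift_eq[OF f S(1) _ S(2)] free_lift_eq[OF h S(1) _ S(2)] by auto
    finally show "free_lift R M g (f \<oplus>\<^bsub>?F\<^esub> h) = free_lift R M g f \<oplus>\<^bsub>M\<^esub> free_lift R M g h" .
  qed
qed

lemma free_lift_basis_vec:
  assumes p: "p \<in> B"
  shows "free_lift R M g (basis_vec R p) = g p"
proof -
  have "free_lift R M g (basis_vec R p) = (\<Oplus>\<^bsub>M\<^esub>q \<in> {p}. basis_vec R p q \<odot>\<^bsub>M\<^esub> g q)"
    by (rule free_lift_eq[OF basis_vec_carrier[OF p]]) (use p in \<open>auto simp: basis_vec_def\<close>)
  then show ?thesis
    using g p by (simp add: basis_vec_def Pi_iff)
qed

end

end

section \<open>Tensor products\<close>

text \<open>Collects the features of a tensor product that enter the length bounds, in a form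
  symmetric in the two factors. The assumption \<open>span\<close> is shaped like an induction rule:
  it is applied to a submodule already known to contain all values of \<open>b\<close>.\<close>

locale bilinear_span =
  U: module R U + W: module R W + P: module R P
  for R :: "('r, 'x) ring_scheme" (structure) and U :: "('r, 'a, 'c) module_scheme" (structure)
    and W :: "('r, 'b, 'd) module_scheme" (structure) and P :: "('r, 'p, 'e) module_scheme" (structure) +
  fixes b :: "'a \<Rightarrow> 'b \<Rightarrow> 'p"
  assumes left: "y \<in> carrier W \<Longrightarrow> linear_map R U P (\<lambda>x. b x y)"
    and right: "x \<in> carrier U \<Longrightarrow> linear_map R W P (b x)"
    and span: "\<lbrakk>submodule N R P; \<And>x y. \<lbrakk>x \<in> carrier U; y \<in> carrier W\<rbrakk> \<Longrightarrow> b x y \<in> N\<rbrakk> \<Longrightarrow> N = carrier P"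

text \<open>Takes the place of commutativity of the tensor product: the same module \<open>P\<close>
  serves both orders of the factors, so one length bound yields the other.\<close>

lemma (in bilinear_span) flip: "bilinear_span R W U P (\<lambda>y x. b x y)"
  by (intro bilinear_span.intro bilinear_span_axioms.intro U.module_axioms W.module_axioms
      P.module_axioms left right span)

locale module_pair = A: module R A + L: module R L
  for R :: "('r, 'x) ring_scheme" (structure) and A :: "('r, 'a, 'c) module_scheme" (structure)
    and L :: "('r, 'l, 'd) module_scheme" (structure)
begin

abbreviation "F \<equiv> free_module R (carrier A \<times> carrier L)"

abbreviation "K \<equiv> gen_submodule R F (tensor_relations R A L)"

sublocale F: module R F by (rule A.free_module_module)

lemma tensor_relations_carrier: "tensor_relations R A L \<subseteq> carrier F"
  by (auto simp: tensor_relations_def Let_def a_minus_def intro!: A.basis_vec_carrier F.add.m_closed F.add.inv_closed)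

sublocale T: module_quotient R F K
  by (rule module_quotient.intro[OF F.module_axioms])
    (simp add: module_quotient_axioms_def F.gen_submodule_submodule tensor_relations_carrier)

definition tensor :: "'a \<Rightarrow> 'l \<Rightarrow> ('a \<times> 'l \<Rightarrow> 'r) set" where
  "tensor a l = T.proj (basis_vec R (a, l))"

lemma tensor_relation_mem_K: "f \<in> tensor_relations R A L \<Longrightarrow> f \<in> K"
  using F.gen_submodule_incl by blast

text \<open>Each bilinearity law is the image of a defining relation, which lies in
  \<open>K\<close>. For spanning, the preimage of \<open>N\<close> in the free module contains all
  basis vectors, hence is everything, and \<open>T.proj\<close> is surjective.\<close>

lemma tensor_bilinear_span: "bilinear_span R A L (tensor_module R A L) tensor"
proof -
  let ?P = "tensor_module R A L" and ?e = "basis_vec R"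
  have P: "?P = T.Q"
    by (simp add: tensor_module_def)
  have e: "?e (a, l) \<in> carrier F" if "a \<in> carrier A" "l \<in> carrier L" for a l
    by (rule A.basis_vec_carrier) (simp add: that)
  have add_left: "tensor (a \<oplus>\<^bsub>A\<^esub> a') l = tensor a l \<oplus>\<^bsub>?P\<^esub> tensor a' l"
    if "a \<in> carrier A" "a' \<in> carrier A" "l \<in> carrier L" for a a' l
  proof -
    have "?e (a \<oplus>\<^bsub>A\<^esub> a', l) \<ominus>\<^bsub>F\<^esub> ?e (a, l) \<ominus>\<^bsub>F\<^esub> ?e (a', l) \<in> K"
      using that by (intro tensor_relation_mem_K) (auto simp: tensor_relations_def Let_def)
    then have "?e (a \<oplus>\<^bsub>A\<^esub> a', l) \<ominus>\<^bsub>F\<^esub> (?e (a, l) \<oplus>\<^bsub>F\<^esub> ?e (a', l)) \<in> K"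
      using that e by (simp add: a_minus_def F.minus_add F.a_ac)
    then show ?thesis
      using that e by (simp add: P tensor_def T.proj_add T.proj_eq_iff)
  qed
  have add_right: "tensor a (l \<oplus>\<^bsub>L\<^esub> l') = tensor a l \<oplus>\<^bsub>?P\<^esub> tensor a l'"
    if "a \<in> carrier A" "l \<in> carrier L" "l' \<in> carrier L" for a l l'
  proof -
    have "?e (a, l \<oplus>\<^bsub>L\<^esub> l') \<ominus>\<^bsub>F\<^esub> ?e (a, l) \<ominus>\<^bsub>F\<^esub> ?e (a, l') \<in> K"
      using that by (intro tensor_relation_mem_K) (auto simp: tensor_relations_def Let_def)
    then have "?e (a, l \<oplus>\<^bsub>L\<^esub> l') \<ominus>\<^bsub>F\<^esub> (?e (a, l) \<oplus>\<^bsub>F\<^esub> ?e (a, l')) \<in> K"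
      using that e by (simp add: a_minus_def F.minus_add F.a_ac)
    then show ?thesis
      using that e by (simp add: P tensor_def T.proj_add T.proj_eq_iff)
  qed
  have smult: "tensor (r \<odot>\<^bsub>A\<^esub> a) l = r \<odot>\<^bsub>?P\<^esub> tensor a l" "tensor a (r \<odot>\<^bsub>L\<^esub> l) = r \<odot>\<^bsub>?P\<^esub> tensor a l"
    if "r \<in> carrier R" "a \<in> carrier A" "l \<in> carrier L" for r a l
  proof -
    have "?e (r \<odot>\<^bsub>A\<^esub> a, l) \<ominus>\<^bsub>F\<^esub> r \<odot>\<^bsub>F\<^esub> ?e (a, l) \<in> tensor_relations R A L"
      "?e (a, r \<odot>\<^bsub>L\<^esub> l) \<ominus>\<^bsub>F\<^esub> r \<odot>\<^bsub>F\<^esub> ?e (a, l) \<in> tensor_relations R A L"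
      unfolding tensor_relations_def Let_def using that by blast+
    note this[THEN tensor_relation_mem_K]
    then show "tensor (r \<odot>\<^bsub>A\<^esub> a) l = r \<odot>\<^bsub>?P\<^esub> tensor a l" "tensor a (r \<odot>\<^bsub>L\<^esub> l) = r \<odot>\<^bsub>?P\<^esub> tensor a l"
      using that e by (simp_all add: P tensor_def T.proj_smult T.proj_eq_iff)
  qed
  have closed: "tensor a l \<in> carrier ?P" if "a \<in> carrier A" "l \<in> carrier L" for a l
    using that e by (auto simp: P tensor_def T.carrier_Q)
  have span: "N = carrier ?P"
    if N: "submodule N R ?P" and t: "\<And>a l. \<lbrakk>a \<in> carrier A; l \<in> carrier L\<rbrakk> \<Longrightarrow> tensor a l \<in> N" for N
  proof -
    have "{f \<in> carrier F. T.proj f \<in> N} = carrier F"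
    proof (rule A.free_module_span)
      show "submodule {f \<in> carrier F. T.proj f \<in> N} R F"
        using submodule_vimage[OF F.module_axioms T.module_Q T.proj_linear] N by (simp add: P)
      show "?e p \<in> {f \<in> carrier F. T.proj f \<in> N}" if "p \<in> carrier A \<times> carrier L" for p
        using that t e by (auto simp: tensor_def)
    qed
    then have "carrier ?P \<subseteq> N"
      by (auto simp: P T.carrier_Q)
    then show ?thesis
      using module.submoduleE(1)[OF T.module_Q, of N] N by (auto simp: P)
  qed
  show ?thesis
    by (intro bilinear_span.intro bilinear_span_axioms.intro)
      (use A.module_axioms L.module_axioms T.module_Q add_left add_right smult closed span in
        \<open>auto simp: linear_map_def P\<close>)
qed

end

section \<open>The residue field and the number of generators\<close>

context cring
begin

lemma ring_module_simps:
  "carrier (ring_module R) = carrier R" "\<zero>\<^bsub>ring_module R\<^esub> = \<zero>" "x \<oplus>\<^bsub>ring_module R\<^esub> y = x \<oplus> y"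
  "a \<odot>\<^bsub>ring_module R\<^esub> x = a \<otimes> x"
  by (simp_all add: ring_module_def)

text \<open>Subtraction depends only on carrier, zero and addition, which
  \<open>ring_module R\<close> shares with \<open>R\<close>.\<close>

lemma ring_module_minus: "x \<ominus>\<^bsub>ring_module R\<^esub> y = x \<ominus> y"
  by (simp add: a_minus_def a_inv_def m_inv_def ring_module_simps)

lemma module_ring_module: "module R (ring_module R)"
proof (rule moduleI)
  show "cring R" by (rule is_cring)
  show "abelian_group (ring_module R)"
  proof (rule abelian_groupI)
    fix x assume "x \<in> carrier (ring_module R)"
    then show "\<exists>y\<in>carrier (ring_module R). y \<oplus>\<^bsub>ring_module R\<^esub> x = \<zero>\<^bsub>ring_module R\<^esub>"
      by (intro bexI[of _ "\<ominus> x"]) (simp_all add: ring_module_simps l_neg)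
  qed (simp_all add: ring_module_simps a_ac)
qed (simp_all add: ring_module_simps l_distr r_distr m_assoc)

lemma ideal_submodule_ring_module:
  assumes "ideal m R"
  shows "submodule m R (ring_module R)"
proof -
  interpret m: ideal m R by fact
  interpret RM: module R "ring_module R" by (rule module_ring_module)
  show ?thesis
    by (rule RM.submodule_of_closed) (auto simp: ring_module_simps m.I_l_closed)
qed

section \<open>Powers of an ideal\<close>

lemma ideal_pow_ideal:
  assumes "ideal m R"
  shows "ideal (ideal_pow R m n) R"
proof (induction n)
  case 0
  then show ?case
    by (simp add: ideal_pow_def ideals_set_def oneideal)
next
  case (Suc n)
  then show ?case
    using ideal_prod_is_ideal[OF _ assms] by (simp add: ideal_pow_def ideals_set_def)
qed

lemma ideal_pow_subset: "ideal m R \<Longrightarrow> ideal_pow R m n \<subseteq> carrier R"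
  by (rule subsetI) (rule ideal.Icarr[OF ideal_pow_ideal])

lemma one_mem_ideal_pow_0: "\<one> \<in> ideal_pow R m 0"
  by (simp add: ideal_pow_def ideals_set_def)

lemma ideal_pow_Suc: "ideal_pow R m (Suc n) = ideal_pow R m n \<cdot> m"
  by (simp add: ideal_pow_def ideals_set_def)

end

context module
begin

lemma smult_diff:
  "\<lbrakk>a \<in> carrier R; c \<in> carrier R; x \<in> carrier M\<rbrakk> \<Longrightarrow> (a \<ominus> c) \<odot>\<^bsub>M\<^esub> x = a \<odot>\<^bsub>M\<^esub> x \<ominus>\<^bsub>M\<^esub> c \<odot>\<^bsub>M\<^esub> x"
  by (simp add: a_minus_def smult_l_distr smult_l_minus)

lemma linear_map_smult: "x \<in> carrier M \<Longrightarrow> linear_map R (ring_module R) M (\<lambda>a. a \<odot>\<^bsub>M\<^esub> x)"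
  by (simp add: linear_map_def R.ring_module_simps smult_l_distr smult_assoc1)

text \<open>The chain is pulled back along the linear map from the free module on \<open>R/m \<times> M\<close> to \<open>M\<close>
  sending the basis vector of \<open>(c, x)\<close> to \<open>r \<odot> x\<close>, where \<open>r\<close> represents \<open>c\<close>; this is bilinear only
  modulo \<open>m M\<close>.\<close>

lemma beta0_ge:
  assumes m: "ideal m R"
    and V: "\<And>i. i \<le> n \<Longrightarrow> submodule (V i) R M"
    and mV: "\<And>i a x. \<lbrakk>i \<le> n; a \<in> m; x \<in> carrier M\<rbrakk> \<Longrightarrow> a \<odot>\<^bsub>M\<^esub> x \<in> V i"
    and mono: "\<And>i. i < n \<Longrightarrow> V i \<subseteq> V (Suc i)"
  shows "enat (card {i. i < n \<and> V i \<noteq> V (Suc i)}) \<le> beta0 R m M"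
proof -
  interpret m: ideal m R by (rule m)
  interpret RM: module R "ring_module R" by (rule R.module_ring_module)
  interpret k: module_quotient R "ring_module R" m
    by (intro module_quotient.intro module_quotient_axioms.intro RM.module_axioms
        R.ideal_submodule_ring_module m)
  let ?k = "residue_module R m"
  have kQ: "?k = k.Q"
    by (simp add: residue_module_def)
  interpret T: module_pair R ?k M
    unfolding kQ by (intro module_pair.intro k.module_Q module_axioms)
  \<comment> \<open>An arbitrary choice of representatives. It need not respect addition or scalars,
    but by \<open>rep_add\<close> and \<open>rep_smult\<close> its errors lie in \<open>m\<close>,
    and \<open>mV\<close> sends multiples by such errors into every \<open>V i\<close>.\<close>
  define rep where "rep c = (SOME r. r \<in> carrier R \<and> k.proj r = c)" for c
  have rep: "rep c \<in> carrier R" "k.proj (rep c) = c" if "c \<in> carrier ?k" for c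
  proof -
    have "\<exists>r. r \<in> carrier R \<and> k.proj r = c"
      using that by (auto simp: kQ k.carrier_Q R.ring_module_simps)
    then show "rep c \<in> carrier R" "k.proj (rep c) = c"
      unfolding rep_def by (metis (mono_tags, lifting) someI_ex)+
  qed
  have rep_eqD: "r \<ominus> r' \<in> m" if "r \<in> carrier R" "r' \<in> carrier R" "k.proj r = k.proj r'" for r r'
    using k.proj_eq_iff[of r r'] that by (simp add: R.ring_module_simps R.ring_module_minus)
  have rep_add: "rep (c \<oplus>\<^bsub>?k\<^esub> c') \<ominus> (rep c \<oplus> rep c') \<in> m" if c: "c \<in> carrier ?k" "c' \<in> carrier ?k" for c c'
  proof (rule rep_eqD)
    show "k.proj (rep (c \<oplus>\<^bsub>?k\<^esub> c')) = k.proj (rep c \<oplus> rep c')"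
      using rep[of c] rep[of c'] rep[of "c \<oplus>\<^bsub>?k\<^esub> c'"] c k.proj_add[of "rep c" "rep c'"]
      by (simp add: R.ring_module_simps kQ[symmetric])
  qed (use rep c in auto)
  have rep_smult: "rep (a \<odot>\<^bsub>?k\<^esub> c) \<ominus> a \<otimes> rep c \<in> m" if c: "a \<in> carrier R" "c \<in> carrier ?k" for a c
  proof (rule rep_eqD)
    show "k.proj (rep (a \<odot>\<^bsub>?k\<^esub> c)) = k.proj (a \<otimes> rep c)"
      using rep[of c] rep[of "a \<odot>\<^bsub>?k\<^esub> c"] c k.proj_smult[of a "rep c"]
      by (simp add: R.ring_module_simps kQ[symmetric])
  qed (use rep c in auto)
  define g where "g = (\<lambda>(c, x). rep c \<odot>\<^bsub>M\<^esub> x)"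
  have g: "g \<in> carrier ?k \<times> carrier M \<rightarrow> carrier M"
    using rep by (auto simp: g_def)
  let ?f = "free_lift R M g"
  have f: "linear_map R T.F M ?f"
    by (rule free_lift_linear[OF g])
  have fe: "?f (basis_vec R (c, x)) = rep c \<odot>\<^bsub>M\<^esub> x" if "c \<in> carrier ?k" "x \<in> carrier M" for c x
    using free_lift_basis_vec[OF g, of "(c, x)"] that by (simp add: g_def)
  have e: "basis_vec R (c, x) \<in> carrier T.F" if "c \<in> carrier ?k" "x \<in> carrier M" for c x
    by (rule R.basis_vec_carrier) (simp add: that)
  note f_diff = linear_map_diff[OF T.F.module_axioms module_axioms f]
  define N where "N i = {h \<in> carrier T.F. ?f h \<in> V i}" for i
  have N: "submodule (N i) R T.F" if "i \<le> n" for i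
    unfolding N_def by (rule submodule_vimage[OF T.F.module_axioms module_axioms f V[OF that]])
  \<comment> \<open>The two kinds of relations that vary the class \<open>c\<close> are sent to an
    error in \<open>m\<close> times \<open>x\<close>, which lies in \<open>V i\<close> by
    \<open>mV\<close>. The two kinds that vary \<open>x\<close> are sent to zero exactly, because
    \<open>rep c\<close> is the same in all terms.\<close>
  have KN: "T.K \<subseteq> N i" if i: "i \<le> n" for i
  proof (rule T.F.gen_submodule_minimal[OF N[OF i]], rule subsetI)
    fix h assume h: "h \<in> tensor_relations R ?k M"
    then have "h \<in> carrier T.F"
      using T.tensor_relations_carrier by blast
    moreover
    consider
      (1) c c' x where "c \<in> carrier ?k" "c' \<in> carrier ?k" "x \<in> carrier M"
        "h = basis_vec R (c \<oplus>\<^bsub>?k\<^esub> c', x) \<ominus>\<^bsub>T.F\<^esub> basis_vec R (c, x) \<ominus>\<^bsub>T.F\<^esub> basis_vec R (c', x)"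
    | (2) c x x' where "c \<in> carrier ?k" "x \<in> carrier M" "x' \<in> carrier M"
        "h = basis_vec R (c, x \<oplus>\<^bsub>M\<^esub> x') \<ominus>\<^bsub>T.F\<^esub> basis_vec R (c, x) \<ominus>\<^bsub>T.F\<^esub> basis_vec R (c, x')"
    | (3) a c x where "a \<in> carrier R" "c \<in> carrier ?k" "x \<in> carrier M"
        "h = basis_vec R (a \<odot>\<^bsub>?k\<^esub> c, x) \<ominus>\<^bsub>T.F\<^esub> a \<odot>\<^bsub>T.F\<^esub> basis_vec R (c, x)"
    | (4) a c x where "a \<in> carrier R" "c \<in> carrier ?k" "x \<in> carrier M"
        "h = basis_vec R (c, a \<odot>\<^bsub>M\<^esub> x) \<ominus>\<^bsub>T.F\<^esub> a \<odot>\<^bsub>T.F\<^esub> basis_vec R (c, x)"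
      using h unfolding tensor_relations_def Let_def
      by (elim UnE CollectE exE conjE) (rule that; assumption)+
    then have "?f h \<in> V i"
    proof cases
      case 1
      then have "?f h = rep (c \<oplus>\<^bsub>?k\<^esub> c') \<odot>\<^bsub>M\<^esub> x \<ominus>\<^bsub>M\<^esub> rep c \<odot>\<^bsub>M\<^esub> x \<ominus>\<^bsub>M\<^esub> rep c' \<odot>\<^bsub>M\<^esub> x"
        by (simp add: f_diff fe e)
      also have "\<dots> = (rep (c \<oplus>\<^bsub>?k\<^esub> c') \<ominus> (rep c \<oplus> rep c')) \<odot>\<^bsub>M\<^esub> x"
        using 1 rep by (simp add: smult_diff smult_l_distr) (simp add: a_minus_def M.minus_add M.a_ac)
      finally show ?thesis
        using 1 mV[OF i rep_add] by simp
    next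
      case 2
      then have "?f h = rep c \<odot>\<^bsub>M\<^esub> (x \<oplus>\<^bsub>M\<^esub> x') \<ominus>\<^bsub>M\<^esub> rep c \<odot>\<^bsub>M\<^esub> x \<ominus>\<^bsub>M\<^esub> rep c \<odot>\<^bsub>M\<^esub> x'"
        by (simp add: f_diff fe e)
      also have "\<dots> = (rep c \<odot>\<^bsub>M\<^esub> x \<ominus>\<^bsub>M\<^esub> rep c \<odot>\<^bsub>M\<^esub> x) \<oplus>\<^bsub>M\<^esub> (rep c \<odot>\<^bsub>M\<^esub> x' \<ominus>\<^bsub>M\<^esub> rep c \<odot>\<^bsub>M\<^esub> x')"
        using 2 rep by (simp add: smult_r_distr) (simp add: a_minus_def M.a_ac)
      also have "\<dots> = \<zero>\<^bsub>M\<^esub>"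
        using 2 rep by (simp add: a_minus_def M.r_neg)
      finally show ?thesis
        using submodule_zero_mem[OF V[OF i]] by simp
    next
      case 3
      then have "?f h = rep (a \<odot>\<^bsub>?k\<^esub> c) \<odot>\<^bsub>M\<^esub> x \<ominus>\<^bsub>M\<^esub> a \<odot>\<^bsub>M\<^esub> (rep c \<odot>\<^bsub>M\<^esub> x)"
        by (simp add: f_diff fe e linear_mapD(3)[OF f])
      also have "\<dots> = (rep (a \<odot>\<^bsub>?k\<^esub> c) \<ominus> a \<otimes> rep c) \<odot>\<^bsub>M\<^esub> x"
        using 3 rep by (simp add: smult_diff smult_assoc1)
      finally show ?thesis
        using 3 mV[OF i rep_smult] by simp
    next
      case 4
      then have "?f h = rep c \<odot>\<^bsub>M\<^esub> (a \<odot>\<^bsub>M\<^esub> x) \<ominus>\<^bsub>M\<^esub> a \<odot>\<^bsub>M\<^esub> (rep c \<odot>\<^bsub>M\<^esub> x)"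
        by (simp add: f_diff fe e linear_mapD(3)[OF f])
      also have "\<dots> = \<zero>\<^bsub>M\<^esub>"
        using 4 rep smult_assoc1[of "rep c" a x] smult_assoc1[of a "rep c" x]
        by (simp add: R.m_comm[of a "rep c"] a_minus_def M.r_neg)
      finally show ?thesis
        using submodule_zero_mem[OF V[OF i]] by simp
    qed
    ultimately show "h \<in> N i"
      by (simp add: N_def)
  qed
  have N_mono: "N i \<subseteq> N (Suc i)" if "i < n" for i
    using mono[OF that] by (auto simp: N_def)
  \<comment> \<open>Membership in \<open>V i\<close> can be read off from \<open>N i\<close> at the
    basis vectors of \<open>(1, x)\<close>: the chosen representative of the class of
    \<open>\<one>\<close> differs from \<open>\<one>\<close> by an element of \<open>m\<close>, and
    that difference times \<open>x\<close> is in \<open>V i\<close>. Hence strict steps of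
    \<open>V\<close> and of \<open>N\<close> occur at the same indices.\<close>
  have V_iff: "x \<in> V i \<longleftrightarrow> basis_vec R (k.proj \<one>, x) \<in> N i" if i: "i \<le> n" and x: "x \<in> carrier M" for i x
  proof -
    let ?c = "k.proj \<one>"
    have c: "?c \<in> carrier ?k"
      by (simp add: kQ k.carrier_Q R.ring_module_simps)
    have "(rep ?c \<ominus> \<one>) \<odot>\<^bsub>M\<^esub> x \<in> V i"
      using mV[OF i rep_eqD x] rep[OF c] by simp
    then have d: "rep ?c \<odot>\<^bsub>M\<^esub> x \<ominus>\<^bsub>M\<^esub> x \<in> V i" (is "?d \<in> _")
      using rep[OF c] x by (simp add: smult_diff)
    have r: "rep ?c \<odot>\<^bsub>M\<^esub> x \<in> carrier M"
      using rep[OF c] x by simp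
    have "rep ?c \<odot>\<^bsub>M\<^esub> x = ?d \<oplus>\<^bsub>M\<^esub> x" "x = rep ?c \<odot>\<^bsub>M\<^esub> x \<ominus>\<^bsub>M\<^esub> ?d"
      using r x by (simp_all add: a_minus_def M.minus_add M.a_ac M.l_neg M.r_neg)
        (simp add: M.a_assoc[symmetric] M.l_neg M.r_neg)
    then have "x \<in> V i \<longleftrightarrow> rep ?c \<odot>\<^bsub>M\<^esub> x \<in> V i"
      using d submoduleE(5)[OF V[OF i]] submodule_diff_mem[OF V[OF i]] by metis
    then show ?thesis
      using c x e by (simp add: N_def fe)
  qed
  have "V i = V (Suc i) \<longleftrightarrow> N i = N (Suc i)" if i: "i < n" for i
  proof
    assume "N i = N (Suc i)"
    then have "\<And>x. x \<in> carrier M \<Longrightarrow> x \<in> V i \<longleftrightarrow> x \<in> V (Suc i)"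
      using V_iff i by simp
    moreover have "V i \<subseteq> carrier M" "V (Suc i) \<subseteq> carrier M"
      using submoduleE(1)[OF V] i by simp_all
    ultimately show "V i = V (Suc i)"
      by blast
  qed (simp add: N_def)
  then have "{i. i < n \<and> V i \<noteq> V (Suc i)} = {i. i < n \<and> N i \<noteq> N (Suc i)}"
    by blast
  moreover have "enat (card {i. i < n \<and> N i \<noteq> N (Suc i)}) \<le> mod_length R T.T.Q"
    by (rule T.T.mod_length_Q_ge) (simp_all add: N KN N_mono)
  ultimately show ?thesis
    by (simp add: beta0_def tensor_module_def)
qed

end

section \<open>Filtrations with quotients killed by the maximal ideal\<close>

context module
begin

text \<open>The last power of \<open>m\<close> that does not carry \<open>M\<close> into
  \<open>S\<close> produces an element outside \<open>S\<close> which \<open>m\<close> multiplies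
  into \<open>S\<close>, that is, a nonzero class of \<open>M/S\<close> killed by
  \<open>m\<close>.\<close>

lemma exists_mod_socle:
  assumes m: "ideal m R" and S: "submodule S R M" "S \<noteq> carrier M"
    and t: "\<And>a x. \<lbrakk>a \<in> ideal_pow R m t; x \<in> carrier M\<rbrakk> \<Longrightarrow> a \<odot>\<^bsub>M\<^esub> x \<in> S"
  shows "\<exists>z\<in>carrier M - S. \<forall>a\<in>m. a \<odot>\<^bsub>M\<^esub> z \<in> S"
  using t
proof (induction t)
  case 0
  \<comment> \<open>\<open>m^0\<close> contains \<open>\<one>\<close>, so the hypothesis makes
    \<open>S\<close> everything, against \<open>S \<noteq> carrier M\<close>.\<close>
  then have "carrier M \<subseteq> S"
    using R.one_mem_ideal_pow_0 smult_one by (metis subsetI)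
  then show ?case
    using S submoduleE(1) by blast
next
  case (Suc t)
  show ?case
  proof (cases "\<forall>a\<in>ideal_pow R m t. \<forall>x\<in>carrier M. a \<odot>\<^bsub>M\<^esub> x \<in> S")
    case True
    then show ?thesis using Suc.IH by blast
  next
    case False
    then obtain a x where a: "a \<in> ideal_pow R m t" "x \<in> carrier M" "a \<odot>\<^bsub>M\<^esub> x \<notin> S"
      by blast
    have aR: "a \<in> carrier R"
      using a R.ideal_pow_subset[OF m] by blast
    have "c \<odot>\<^bsub>M\<^esub> (a \<odot>\<^bsub>M\<^esub> x) \<in> S" if c: "c \<in> m" for c
    proof -
      have cR: "c \<in> carrier R"
        using c m ideal.Icarr by fastforce
      have "(a \<otimes> c) \<odot>\<^bsub>M\<^esub> x \<in> S"
        using Suc.prems a c by (simp add: R.ideal_pow_Suc ideal_prod.prod)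
      then show ?thesis
        using aR cR a by (simp add: smult_assoc1 R.m_comm[of a c])
    qed
    then show ?thesis
      using a aR by blast
  qed
qed

text \<open>As long as \<open>S\<close> is not everything, \<open>exists_mod_socle\<close> gives a
  generator \<open>x\<close> to adjoin. Every strict chain above \<open>S + R x\<close> can be
  prolonged downwards by \<open>S\<close>, so the bound \<open>n\<close> drops with each adjunction
  and the process stops after at most \<open>n\<close> steps.\<close>

lemma exists_filtration:
  assumes m: "ideal m R" and S: "submodule S R M"
    and t: "\<And>a x. \<lbrakk>a \<in> ideal_pow R m t; x \<in> carrier M\<rbrakk> \<Longrightarrow> a \<odot>\<^bsub>M\<^esub> x \<in> S"
    and bound: "\<And>k N. \<lbrakk>\<And>i. i \<le> k \<Longrightarrow> submodule (N i) R M; S \<subseteq> N 0;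
      \<And>i. i < k \<Longrightarrow> N i \<subset> N (Suc i)\<rbrakk> \<Longrightarrow> k \<le> n"
  obtains l Z z where "l \<le> n" "Z 0 = S" "Z l = carrier M" "\<And>i. i \<le> l \<Longrightarrow> submodule (Z i) R M"
    "\<And>i. i < l \<Longrightarrow> z i \<in> carrier M"
    "\<And>i. i < l \<Longrightarrow> Z (Suc i) = Z i <+>\<^bsub>M\<^esub> (\<lambda>a. a \<odot>\<^bsub>M\<^esub> z i) ` carrier R"
    "\<And>i a. \<lbrakk>i < l; a \<in> m\<rbrakk> \<Longrightarrow> a \<odot>\<^bsub>M\<^esub> z i \<in> Z i"
  using S t bound
proof (induction n arbitrary: S thesis rule: less_induct)
  case (less n)
  show ?case
  proof (cases "S = carrier M")
    case True
    then show ?thesis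
      using less.prems(1)[of 0 "\<lambda>_. S"] less.prems(2) by simp
  next
    case False
    obtain x where x: "x \<in> carrier M" "x \<notin> S" "\<And>a. a \<in> m \<Longrightarrow> a \<odot>\<^bsub>M\<^esub> x \<in> S"
      using exists_mod_socle[OF m less.prems(2) False less.prems(3)] by blast
    let ?C = "(\<lambda>a. a \<odot>\<^bsub>M\<^esub> x) ` carrier R"
    let ?S = "S <+>\<^bsub>M\<^esub> ?C"
    have C: "submodule ?C R M"
      using submodule_image[OF R.module_ring_module module_axioms linear_map_smult[OF x(1)]
          module.carrier_is_submodule[OF R.module_ring_module]]
      by (simp add: R.ring_module_simps)
    have S': "submodule ?S R M"
      by (rule submodule_sum[OF less.prems(2) C])
    have sub: "S \<subseteq> ?S" "?C \<subseteq> ?S"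
      using submodule_sum_upper[OF less.prems(2) C] by blast+
    moreover have "x \<in> ?C"
      using x(1) smult_one by (metis R.one_closed imageI)
    ultimately have SS: "S \<subset> ?S"
      using x(2) by blast
    \<comment> \<open>The prolonged chain has \<open>S\<close> in front and the given chain shifted
      by one.\<close>
    have bound': "Suc k \<le> n" if "\<And>i. i \<le> k \<Longrightarrow> submodule (N i) R M" "?S \<subseteq> N 0"
      "\<And>i. i < k \<Longrightarrow> N i \<subset> N (Suc i)" for k N
    proof (rule less.prems(4)[of "Suc k" "case_nat S N"])
      show "submodule (case_nat S N i) R M" if "i \<le> Suc k" for i
        using that less.prems(2) \<open>\<And>i. i \<le> k \<Longrightarrow> submodule (N i) R M\<close> by (cases i) auto
      show "case_nat S N i \<subset> case_nat S N (Suc i)" if "i < Suc k" for i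
        using that SS \<open>?S \<subseteq> N 0\<close> \<open>\<And>i. i < k \<Longrightarrow> N i \<subset> N (Suc i)\<close> by (cases i) auto
    qed simp
    \<comment> \<open>Subtraction is truncated, so \<open>n\<close> must be positive: the chain of
      one step from \<open>S\<close> to \<open>S + R x\<close> shows it.\<close>
    have n: "n - 1 < n"
      using bound'[of 0 "\<lambda>_. ?S"] S' by simp
    obtain l Z z where *: "l \<le> n - 1" "Z 0 = ?S" "Z l = carrier M" "\<And>i. i \<le> l \<Longrightarrow> submodule (Z i) R M"
      "\<And>i. i < l \<Longrightarrow> z i \<in> carrier M"
      "\<And>i. i < l \<Longrightarrow> Z (Suc i) = Z i <+>\<^bsub>M\<^esub> (\<lambda>a. a \<odot>\<^bsub>M\<^esub> z i) ` carrier R"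
      "\<And>i a. \<lbrakk>i < l; a \<in> m\<rbrakk> \<Longrightarrow> a \<odot>\<^bsub>M\<^esub> z i \<in> Z i"
    proof (rule less.IH[OF n _ S'])
      show "a \<odot>\<^bsub>M\<^esub> y \<in> ?S" if "a \<in> ideal_pow R m t" "y \<in> carrier M" for a y
        using that less.prems(3) sub by blast
      show "k \<le> n - 1" if "\<And>i. i \<le> k \<Longrightarrow> submodule (N i) R M" "?S \<subseteq> N 0"
        "\<And>i. i < k \<Longrightarrow> N i \<subset> N (Suc i)" for k N
      proof -
        have "Suc k \<le> n"
          by (rule bound'[of k N]) (simp_all add: that)
        then show ?thesis by simp
      qed
    qed blast
    show ?thesis
    proof (rule less.prems(1)[of "Suc l" "case_nat S Z" "case_nat x z"])
      show "Suc l \<le> n"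
        using *(1) n by linarith
      show "submodule (case_nat S Z i) R M" if "i \<le> Suc l" for i
        using that *(4) less.prems(2) by (cases i) auto
      show "case_nat x z i \<in> carrier M" if "i < Suc l" for i
        using that *(5) x(1) by (cases i) auto
      show "case_nat S Z (Suc i) = case_nat S Z i <+>\<^bsub>M\<^esub> (\<lambda>a. a \<odot>\<^bsub>M\<^esub> case_nat x z i) ` carrier R"
        if "i < Suc l" for i
        using that *(2,6) by (cases i) auto
      show "a \<odot>\<^bsub>M\<^esub> case_nat x z i \<in> case_nat S Z i" if "i < Suc l" "a \<in> m" for i a
        using that *(7) x(3) by (cases i) auto
    qed (use *(3) in simp_all)
  qed
qed

end

section \<open>Bounding the length of a bilinear image\<close>

context bilinear_span
begin

lemma b_closed: "\<lbrakk>x \<in> carrier U; y \<in> carrier W\<rbrakk> \<Longrightarrow> b x y \<in> carrier P"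
  using linear_mapD(1)[OF right] .

lemma b_smult:
  "\<lbrakk>a \<in> carrier R; x \<in> carrier U; y \<in> carrier W\<rbrakk> \<Longrightarrow> b (a \<odot>\<^bsub>U\<^esub> x) y = a \<odot>\<^bsub>P\<^esub> b x y"
  "\<lbrakk>a \<in> carrier R; x \<in> carrier U; y \<in> carrier W\<rbrakk> \<Longrightarrow> b x (a \<odot>\<^bsub>W\<^esub> y) = a \<odot>\<^bsub>P\<^esub> b x y"
  using linear_mapD(3)[OF left] linear_mapD(3)[OF right] by auto

lemma b_add_right:
  "\<lbrakk>x \<in> carrier U; y \<in> carrier W; y' \<in> carrier W\<rbrakk> \<Longrightarrow> b x (y \<oplus>\<^bsub>W\<^esub> y') = b x y \<oplus>\<^bsub>P\<^esub> b x y'"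
  using linear_mapD(2)[OF right] .

lemma annihilator_submodule:
  assumes "D \<subseteq> carrier U"
  shows "submodule {y \<in> carrier W. \<forall>x\<in>D. b x y = \<zero>\<^bsub>P\<^esub>} R W"
  by (rule W.submodule_of_closed)
    (use assms right in \<open>auto simp: subset_iff b_add_right b_smult
      linear_map_zero[OF W.module_axioms P.module_axioms]\<close>)

text \<open>A chain \<open>N\<close> in \<open>P\<close> is compared with the traces \<open>{y. b (z i) y \<in> T i + N j}\<close> it leaves on \<open>W\<close>,
  where \<open>T i\<close> is the submodule spanned by \<open>b (Z i) W\<close>: each strict step of \<open>N\<close> is strict in at least
  one trace, and each trace has at most \<open>beta0 R m W\<close> strict steps.\<close>

lemma chain_length_le:
  assumes m: "ideal m R"
    and Z: "Z l = carrier U" "\<And>i. i \<le> l \<Longrightarrow> submodule (Z i) R U"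
      "\<And>i. i < l \<Longrightarrow> Z (Suc i) = Z i <+>\<^bsub>U\<^esub> (\<lambda>a. a \<odot>\<^bsub>U\<^esub> z i) ` carrier R"
    and z: "\<And>i. i < l \<Longrightarrow> z i \<in> carrier U"
    and mz: "\<And>i a. \<lbrakk>i < l; a \<in> m\<rbrakk> \<Longrightarrow> a \<odot>\<^bsub>U\<^esub> z i \<in> Z i"
    and Z0: "\<And>x y. \<lbrakk>x \<in> Z 0; y \<in> carrier W\<rbrakk> \<Longrightarrow> b x y = \<zero>\<^bsub>P\<^esub>"
    and N: "\<And>j. j \<le> n \<Longrightarrow> submodule (N j) R P" "\<And>j. j < n \<Longrightarrow> N j \<subset> N (Suc j)"
  shows "enat n \<le> enat l * beta0 R m W"
proof -
  \<comment> \<open>\<open>T i\<close> is built as the sum of the images \<open>b (z k) W\<close>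
    for \<open>k < i\<close>, which makes it a submodule with an explicit decomposition of its
    elements. It starts at zero because \<open>b\<close> vanishes on \<open>Z 0\<close>.\<close>
  define T where "T = rec_nat {\<zero>\<^bsub>P\<^esub>} (\<lambda>i T. T <+>\<^bsub>P\<^esub> b (z i) ` carrier W)"
  have T_0: "T 0 = {\<zero>\<^bsub>P\<^esub>}" and T_Suc: "T (Suc i) = T i <+>\<^bsub>P\<^esub> b (z i) ` carrier W" for i
    by (simp_all add: T_def)
  have im: "submodule (b (z i) ` carrier W) R P" if "i < l" for i
    by (rule submodule_image[OF W.module_axioms P.module_axioms right W.carrier_is_submodule])
      (use that z in blast)
  have T: "submodule (T i) R P" if "i \<le> l" for i
    using that
  proof (induction i)
    case 0
    then show ?case by (simp add: T_0 P.zero_submodule)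
  next
    case (Suc i)
    then show ?case using P.submodule_sum[OF _ im] by (simp add: T_Suc)
  qed
  have bT: "b x y \<in> T i" if "i \<le> l" "x \<in> Z i" "y \<in> carrier W" for i x y
    using that
  proof (induction i arbitrary: x y)
    case 0
    then show ?case by (simp add: T_0 Z0)
  next
    case (Suc i)
    then obtain s a where s: "s \<in> Z i" "a \<in> carrier R" "x = s \<oplus>\<^bsub>U\<^esub> a \<odot>\<^bsub>U\<^esub> z i"
      using Z(3)[of i] by (auto simp: set_add_def')
    have sU: "s \<in> carrier U"
      using s(1) Z(2)[of i] U.submoduleE(1) Suc.prems(1) by fastforce
    have zU: "z i \<in> carrier U"
      using z Suc.prems(1) by simp
    \<comment> \<open>The coefficient \<open>a\<close> of \<open>z i\<close> is moved to the second
      argument, so that this term lies in the image \<open>b (z i) W\<close>.\<close>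
    have "b x y = b s y \<oplus>\<^bsub>P\<^esub> b (z i) (a \<odot>\<^bsub>W\<^esub> y)"
      using s sU zU Suc.prems(3) linear_mapD(2)[OF left[OF Suc.prems(3)], of s "a \<odot>\<^bsub>U\<^esub> z i"]
      by (simp add: b_smult)
    moreover have "b s y \<in> T i"
      using Suc s by simp
    moreover have "a \<odot>\<^bsub>W\<^esub> y \<in> carrier W"
      using s Suc.prems by simp
    ultimately show ?case
      unfolding T_Suc set_add_def' by blast
  qed
  have T_l: "T l = carrier P"
    using span[OF T[of l]] bT[of l] Z(1) by simp
  define V where "V i j = {y \<in> carrier W. b (z i) y \<in> T i <+>\<^bsub>P\<^esub> N j}" for i j
  have NP: "N j \<subseteq> carrier P" if "j \<le> n" for j
    using N(1)[OF that] P.submoduleE(1) by blast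
  have TP: "T i \<subseteq> carrier P" if "i \<le> l" for i
    using T[OF that] P.submoduleE(1) by blast
  \<comment> \<open>If no trace detects the step, then \<open>N (Suc j)\<close> meets each
    \<open>T i\<close> inside \<open>N j\<close>, by induction on \<open>i\<close>. At
    \<open>i = l\<close> the term \<open>T l\<close> is all of \<open>P\<close>, so the step is not
    strict.\<close>
  have step: "N j = N (Suc j)" if j: "j < n" and V_eq: "\<And>i. i < l \<Longrightarrow> V i j = V i (Suc j)" for j
  proof -
    have "N (Suc j) \<inter> T i \<subseteq> N j" if "i \<le> l" for i
      using that
    proof (induction i)
      case 0
      then show ?case
        using P.submodule_zero_mem[OF N(1)[of j]] j by (auto simp: T_0)
    next
      case (Suc i)
      then have i: "i < l" by simp
      show ?case
      proof
        fix w assume w: "w \<in> N (Suc j) \<inter> T (Suc i)"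
        then obtain u y where u: "u \<in> T i" and y: "y \<in> carrier W" and w_eq: "w = u \<oplus>\<^bsub>P\<^esub> b (z i) y"
          by (auto simp: T_Suc set_add_def')
        have carr: "w \<in> carrier P" "u \<in> carrier P" "b (z i) y \<in> carrier P"
          using w NP[of "Suc j"] j u TP[of i] i b_closed[OF z y] by auto
        have "b (z i) y = (\<ominus>\<^bsub>P\<^esub> u) \<oplus>\<^bsub>P\<^esub> w"
          using carr by (simp add: w_eq P.a_assoc[symmetric] P.l_neg)
        moreover have "\<ominus>\<^bsub>P\<^esub> u \<in> T i"
          using u P.submoduleE(3)[OF T] i by simp
        ultimately have "y \<in> V i (Suc j)"
          using w y unfolding V_def set_add_def' by blast
        \<comment> \<open>Equality of traces replaces \<open>b (z i) y\<close> by
          \<open>u' + v\<close> with \<open>v\<close> in the smaller \<open>N j\<close>. Then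
          \<open>w - v = u + u'\<close> lies in \<open>T i\<close> as well as in
          \<open>N (Suc j)\<close>, where the induction hypothesis applies.\<close>
        then have "y \<in> V i j"
          using V_eq[OF i] by simp
        then obtain u' v where u': "u' \<in> T i" and v: "v \<in> N j" and b_eq: "b (z i) y = u' \<oplus>\<^bsub>P\<^esub> v"
          by (auto simp: V_def set_add_def')
        have carr': "u' \<in> carrier P" "v \<in> carrier P"
          using u' v TP[of i] NP[of j] i j by auto
        have w_eq': "w = (u \<oplus>\<^bsub>P\<^esub> u') \<oplus>\<^bsub>P\<^esub> v"
          using carr carr' by (simp add: w_eq b_eq P.a_assoc)
        then have "u \<oplus>\<^bsub>P\<^esub> u' = w \<ominus>\<^bsub>P\<^esub> v"
          using carr carr' by (simp add: a_minus_def P.a_assoc P.r_neg)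
        moreover have "v \<in> N (Suc j)"
          using v N(2)[OF j] by blast
        ultimately have "u \<oplus>\<^bsub>P\<^esub> u' \<in> N (Suc j)"
          using w P.submodule_diff_mem[OF N(1)[of "Suc j"]] j by simp
        moreover have "u \<oplus>\<^bsub>P\<^esub> u' \<in> T i"
          using u u' P.submoduleE(5)[OF T] i by simp
        ultimately have "u \<oplus>\<^bsub>P\<^esub> u' \<in> N j"
          using Suc.IH i by auto
        then show "w \<in> N j"
          using v P.submoduleE(5)[OF N(1)[of j]] j by (simp add: w_eq')
      qed
    qed
    from this[of l] show ?thesis
      using T_l NP[of "Suc j"] N(2)[OF j] j by auto
  qed
  let ?J = "\<lambda>i. {j. j < n \<and> V i j \<noteq> V i (Suc j)}"
  have J: "enat (card (?J i)) \<le> beta0 R m W" if i: "i < l" for i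
  proof (rule W.beta0_ge[OF m])
    have sum: "submodule (T i <+>\<^bsub>P\<^esub> N j) R P" if "j \<le> n" for j
      using P.submodule_sum[OF T N(1)] i that by simp
    show "submodule (V i j) R W" if "j \<le> n" for j
      unfolding V_def
      by (rule submodule_vimage[OF W.module_axioms P.module_axioms right[OF z[OF i]] sum[OF that]])
    show "a \<odot>\<^bsub>W\<^esub> y \<in> V i j" if j: "j \<le> n" and a: "a \<in> m" and y: "y \<in> carrier W" for j a y
    proof -
      have aR: "a \<in> carrier R"
        using a m ideal.Icarr by fastforce
      \<comment> \<open>Moving \<open>a\<close> to the first argument shows that each trace contains
        \<open>m W\<close>, as required by \<open>W.beta0_ge\<close>: \<open>a\<close> times
        \<open>z i\<close> is in \<open>Z i\<close>, whose products with \<open>W\<close> are in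
        \<open>T i\<close>.\<close>
      have "b (z i) (a \<odot>\<^bsub>W\<^esub> y) = b (a \<odot>\<^bsub>U\<^esub> z i) y"
        using aR y z[OF i] by (simp add: b_smult)
      also have "\<dots> \<in> T i"
        using bT mz a i y by simp
      finally show ?thesis
        using subsetD[OF P.submodule_sum_upper(1)[OF T[of i] N(1)[of j]]] i j aR y
        by (simp add: V_def)
    qed
    show "V i j \<subseteq> V i (Suc j)" if "j < n" for j
      using N(2)[OF that] by (auto simp: V_def set_add_def')
  qed
  have "\<exists>i<l. V i j \<noteq> V i (Suc j)" if j: "j < n" for j
  proof (rule ccontr)
    assume "\<not> (\<exists>i<l. V i j \<noteq> V i (Suc j))"
    then have "N j = N (Suc j)"
      by (intro step[OF j]) simp
    then show False
      using N(2)[OF j] by simp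
  qed
  \<comment> \<open>Counting: the \<open>n\<close> steps of the chain are covered by
    \<open>l\<close> index sets, each of size at most \<open>beta0 R m W\<close>.\<close>
  then have "{..<n} \<subseteq> (\<Union>i<l. ?J i)"
    by (simp add: subset_iff Bex_def)
  then have "n \<le> card (\<Union>i<l. ?J i)"
    using card_mono[of "\<Union>i<l. ?J i" "{..<n}"] by simp
  also have "\<dots> \<le> (\<Sum>i<l. card (?J i))"
    by (rule card_UN_le) simp
  finally have "enat n \<le> enat (\<Sum>i<l. card (?J i))"
    by simp
  also have "\<dots> = (\<Sum>i<l. enat (card (?J i)))"
    by (induction l) (simp_all add: zero_enat_def flip: plus_enat_simps(1))
  also have "\<dots> \<le> of_nat (card {..<l}) * beta0 R m W"
    by (rule sum_bounded_above) (use J in simp)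
  finally show ?thesis
    by (simp add: of_nat_eq_enat)
qed

text \<open>If \<open>beta0 R m W\<close> is zero, every submodule of \<open>W\<close> containing
  \<open>m W\<close> is \<open>W\<close>. The elements of \<open>W\<close> annihilated by
  \<open>m^t U\<close> form such a submodule, since moving a scalar of \<open>m\<close> across
  \<open>b\<close> turns \<open>m^t U\<close> into \<open>m^(t+1) U\<close>. So the exponent can be
  lowered to 0, where \<open>b\<close> itself vanishes.\<close>

lemma trivial_if_beta0_eq_0:
  assumes m: "ideal m R" and beta: "beta0 R m W = 0"
    and t: "\<And>a x y. \<lbrakk>a \<in> ideal_pow R m t; x \<in> carrier U; y \<in> carrier W\<rbrakk> \<Longrightarrow> b (a \<odot>\<^bsub>U\<^esub> x) y = \<zero>\<^bsub>P\<^esub>"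
  shows "carrier P = {\<zero>\<^bsub>P\<^esub>}"
  using t
proof (induction t)
  case 0
  have "b x y = \<zero>\<^bsub>P\<^esub>" if "x \<in> carrier U" "y \<in> carrier W" for x y
    using 0[OF U.R.one_mem_ideal_pow_0 that] that by simp
  then show ?case
    using span[OF P.zero_submodule] by simp
next
  case (Suc t)
  let ?X = "{a \<odot>\<^bsub>U\<^esub> x | a x. a \<in> ideal_pow R m t \<and> x \<in> carrier U}"
  let ?V = "{y \<in> carrier W. \<forall>x\<in>?X. b x y = \<zero>\<^bsub>P\<^esub>}"
  have X: "?X \<subseteq> carrier U"
    using U.R.ideal_pow_subset[OF m] by auto
  have V: "submodule ?V R W"
    by (rule annihilator_submodule[OF X])
  have mV: "c \<odot>\<^bsub>W\<^esub> y \<in> ?V" if c: "c \<in> m" and y: "y \<in> carrier W" for c y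
  proof -
    have cR: "c \<in> carrier R"
      using c m ideal.Icarr by fastforce
    have "b (a \<odot>\<^bsub>U\<^esub> x) (c \<odot>\<^bsub>W\<^esub> y) = \<zero>\<^bsub>P\<^esub>" if a: "a \<in> ideal_pow R m t" and x: "x \<in> carrier U" for a x
    proof -
      have aR: "a \<in> carrier R"
        using a U.R.ideal_pow_subset[OF m] by blast
      have "b (a \<odot>\<^bsub>U\<^esub> x) (c \<odot>\<^bsub>W\<^esub> y) = b ((a \<otimes> c) \<odot>\<^bsub>U\<^esub> x) y"
        using aR cR x y by (simp add: b_smult P.smult_assoc1 U.R.m_comm[of a c] b_closed)
      then show ?thesis
        using Suc.prems[OF _ x y, of "a \<otimes> c"] a c by (simp add: U.R.ideal_pow_Suc ideal_prod.prod)
    qed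
    then show ?thesis
      using cR y by auto
  qed
  \<comment> \<open>The chain from \<open>?V\<close> to \<open>W\<close> has a single step, which
    cannot be strict when \<open>beta0 R m W\<close> is zero.\<close>
  let ?N = "case_nat ?V (\<lambda>_. carrier W)"
  have "enat (card {i. i < 1 \<and> ?N i \<noteq> ?N (Suc i)}) \<le> beta0 R m W"
    by (rule W.beta0_ge[OF m])
      (use V mV W.carrier_is_submodule ideal.Icarr[OF m] in \<open>auto split: nat.split\<close>)
  then have "{i. i < 1 \<and> ?N i \<noteq> ?N (Suc i)} = {}"
    by (simp add: beta zero_enat_def)
  then have "\<not> (0 < (1::nat) \<and> ?N 0 \<noteq> ?N (Suc 0))"
    by blast
  then have "?V = carrier W"
    by simp
  then show ?case
    by (intro Suc.IH) blast
qed

text \<open>A finite length of \<open>U/S\<close> bounds the strict chains above \<open>S\<close>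
  and so yields a filtration for \<open>chain_length_le\<close>. If it is infinite, the product is
  infinite unless \<open>beta0 R m W\<close> is zero; then the product is zero in
  \<open>enat\<close>, and \<open>P\<close> has to be trivial.\<close>

theorem mod_length_le_mult_beta0:
  assumes m: "ideal m R" and S: "submodule S R U"
    and t: "\<And>a x. \<lbrakk>a \<in> ideal_pow R m t; x \<in> carrier U\<rbrakk> \<Longrightarrow> a \<odot>\<^bsub>U\<^esub> x \<in> S"
    and bS: "\<And>x y. \<lbrakk>x \<in> S; y \<in> carrier W\<rbrakk> \<Longrightarrow> b x y = \<zero>\<^bsub>P\<^esub>"
  shows "mod_length R P \<le> mod_length R (quot_module R U S) * beta0 R m W"
proof (cases "mod_length R (quot_module R U S)")
  case (enat n)
  interpret Q: module_quotient R U S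
    by (intro module_quotient.intro module_quotient_axioms.intro U.module_axioms S)
  have bound: "k \<le> n" if N: "\<And>i. i \<le> k \<Longrightarrow> submodule (N i) R U" "S \<subseteq> N 0"
    "\<And>i. i < k \<Longrightarrow> N i \<subset> N (Suc i)" for k and N :: "nat \<Rightarrow> 'a set"
  proof -
    have "S \<subseteq> N i" if "i \<le> k" for i
      using that
    proof (induction i)
      case 0
      then show ?case using N(2) by simp
    next
      case (Suc i)
      then show ?case using N(3)[of i] by auto
    qed
    then have "enat (card {i. i < k \<and> N i \<noteq> N (Suc i)}) \<le> mod_length R Q.Q"
      by (intro Q.mod_length_Q_ge) (simp_all add: N psubset_imp_subset)
    moreover have "{i. i < k \<and> N i \<noteq> N (Suc i)} = {..<k}"
      using N(3) by auto
    ultimately show ?thesis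
      by (simp add: enat)
  qed
  obtain l Z z where Z: "l \<le> n" "Z 0 = S" "Z l = carrier U" "\<And>i. i \<le> l \<Longrightarrow> submodule (Z i) R U"
    "\<And>i. i < l \<Longrightarrow> z i \<in> carrier U"
    "\<And>i. i < l \<Longrightarrow> Z (Suc i) = Z i <+>\<^bsub>U\<^esub> (\<lambda>a. a \<odot>\<^bsub>U\<^esub> z i) ` carrier R"
    "\<And>i a. \<lbrakk>i < l; a \<in> m\<rbrakk> \<Longrightarrow> a \<odot>\<^bsub>U\<^esub> z i \<in> Z i"
  proof (rule U.exists_filtration[where t = t, OF m S])
    show "a \<odot>\<^bsub>U\<^esub> x \<in> S" if "a \<in> ideal_pow R m t" "x \<in> carrier U" for a x
      using that by (rule t)
    show "k \<le> n" if "\<And>i. i \<le> k \<Longrightarrow> submodule (N i) R U" "S \<subseteq> N 0"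
      "\<And>i. i < k \<Longrightarrow> N i \<subset> N (Suc i)" for k and N :: "nat \<Rightarrow> 'a set"
      by (rule bound[of k N]) (simp_all add: that)
  qed (rule that)
  have "mod_length R P \<le> enat l * beta0 R m W"
  proof (rule mod_length_le)
    fix k and N :: "nat \<Rightarrow> 'p set"
    assume N: "\<And>i. i \<le> k \<Longrightarrow> submodule (N i) R P" "\<And>i. i < k \<Longrightarrow> N i \<subset> N (Suc i)"
    show "enat k \<le> enat l * beta0 R m W"
      by (rule chain_length_le[of m Z l z k N, OF m Z(3)]) (simp_all add: Z(2,4-7) bS N)
  qed
  also have "\<dots> \<le> enat n * beta0 R m W"
    using Z(1) by (intro mult_right_mono) auto
  finally show ?thesis
    by (simp add: enat)
next
  case infinity
  show ?thesis
  proof (cases "beta0 R m W = 0")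
    case True
    then have P: "carrier P = {\<zero>\<^bsub>P\<^esub>}"
      using trivial_if_beta0_eq_0[OF m] t bS by blast
    have "mod_length R P \<le> 0"
    proof (rule mod_length_le)
      fix k and N :: "nat \<Rightarrow> 'p set"
      assume N: "\<And>i. i \<le> k \<Longrightarrow> submodule (N i) R P" "\<And>i. i < k \<Longrightarrow> N i \<subset> N (Suc i)"
      have N_eq: "N i = {\<zero>\<^bsub>P\<^esub>}" if "i \<le> k" for i
        using P.submoduleE(1)[OF N(1)[OF that]] P.submodule_zero_mem[OF N(1)[OF that]] P by blast
      show "enat k \<le> 0"
        using N(2)[of 0] N_eq[of 0] N_eq[of "Suc 0"] by (cases k) (auto simp: zero_enat_def)
    qed
    then show ?thesis by simp
  next
    case False
    then have "\<infinity> * beta0 R m W = \<infinity>"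
      by (simp add: imult_is_infinity)
    then show ?thesis
      by (simp add: infinity)
  qed
qed

end

section \<open>Vanishing of tensors with first factor in the stable part of \<open>A\<close>\<close>

context module_pair
begin

text \<open>Induction on the exponent \<open>n\<close> that kills \<open>l\<close>. By stability
  \<open>x\<close> lies in \<open>m^(t+1) A\<close>, which is generated by elements
  \<open>c (d y)\<close> with \<open>c\<close> in \<open>m\<close> and \<open>d\<close> in
  \<open>m^t\<close>. Moving \<open>c\<close> onto \<open>l\<close> lowers the exponent by one,
  while \<open>d y\<close> is still in \<open>m^t A\<close>. At exponent 0 the element
  \<open>l\<close> is zero.\<close>

lemma tensor_ideal_pow_eq_zero:
  assumes m: "ideal m R"
    and stable: "ideal_smult R (ideal_pow R m t) A = ideal_smult R (ideal_pow R m (Suc t)) A"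
    and l: "l \<in> carrier L" "\<And>a. a \<in> ideal_pow R m n \<Longrightarrow> a \<odot>\<^bsub>L\<^esub> l = \<zero>\<^bsub>L\<^esub>"
    and x: "x \<in> ideal_smult R (ideal_pow R m t) A"
  shows "tensor x l = \<zero>\<^bsub>tensor_module R A L\<^esub>"
  using l x
proof (induction n arbitrary: l x)
  case 0
  interpret b: bilinear_span R A L "tensor_module R A L" tensor
    by (rule tensor_bilinear_span)
  have "x \<in> carrier A"
    using 0(3) A.submoduleE(1)[OF A.ideal_smult_submodule[OF A.R.ideal_pow_subset[OF m]]] by blast
  moreover have "l = \<zero>\<^bsub>L\<^esub>"
    using 0(2)[OF A.R.one_mem_ideal_pow_0] 0(1) by simp
  ultimately show ?case
    using linear_map_zero[OF L.module_axioms b.P.module_axioms b.right] by simp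
next
  case (Suc n)
  interpret b: bilinear_span R A L "tensor_module R A L" tensor
    by (rule tensor_bilinear_span)
  let ?D = "{x \<in> carrier A. tensor x l \<in> {\<zero>\<^bsub>tensor_module R A L\<^esub>}}"
  have D: "submodule ?D R A"
    by (rule submodule_vimage[OF A.module_axioms b.P.module_axioms b.left[OF Suc.prems(1)]
          b.P.zero_submodule])
  \<comment> \<open>Elements of \<open>m^(t+1)\<close> are sums of products \<open>d c\<close>, so
    the claim is proved by induction over the ideal product; sums are harmless because
    \<open>?D\<close> is a submodule.\<close>
  have "a \<odot>\<^bsub>A\<^esub> y \<in> ?D" if a: "a \<in> ideal_pow R m (Suc t)" and y: "y \<in> carrier A" for a y
    using a unfolding A.R.ideal_pow_Suc
  proof (induction a rule: ideal_prod.induct)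
    case (prod d c)
    have R: "d \<in> carrier R" "c \<in> carrier R"
      using prod A.R.ideal_pow_subset[OF m] ideal.Icarr[OF m] by auto
    have "tensor (d \<odot>\<^bsub>A\<^esub> y) (c \<odot>\<^bsub>L\<^esub> l) = \<zero>\<^bsub>tensor_module R A L\<^esub>"
    proof (rule Suc.IH)
      show "a \<odot>\<^bsub>L\<^esub> (c \<odot>\<^bsub>L\<^esub> l) = \<zero>\<^bsub>L\<^esub>" if "a \<in> ideal_pow R m n" for a
      proof -
        have "a \<in> carrier R"
          using that A.R.ideal_pow_subset[OF m] by blast
        then show ?thesis
          \<comment> \<open>For \<open>a\<close> in \<open>m^n\<close> the product
            \<open>a c\<close> is in \<open>m^(n+1)\<close>, which kills \<open>l\<close>.\<close>
          using Suc.prems(2)[of "a \<otimes> c"] that prod(2) R Suc.prems(1)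
          by (simp add: A.R.ideal_pow_Suc ideal_prod.prod L.smult_assoc1)
      qed
      show "d \<odot>\<^bsub>A\<^esub> y \<in> ideal_smult R (ideal_pow R m t) A"
        by (rule A.ideal_smult_mem[OF prod(1) y])
    qed (use R Suc.prems in simp)
    moreover have "(d \<otimes> c) \<odot>\<^bsub>A\<^esub> y = c \<odot>\<^bsub>A\<^esub> (d \<odot>\<^bsub>A\<^esub> y)"
      using R y by (simp add: A.R.m_comm[of d c] A.smult_assoc1)
    ultimately show ?case
      using R y Suc.prems(1) by (simp add: b.b_smult)
  next
    case (sum s1 s2)
    have "s1 \<in> carrier R" "s2 \<in> carrier R"
      using sum.hyps A.R.ideal_prod_in_carrier[OF A.R.ideal_pow_ideal[OF m] m] by auto
    then have "(s1 \<oplus> s2) \<odot>\<^bsub>A\<^esub> y = s1 \<odot>\<^bsub>A\<^esub> y \<oplus>\<^bsub>A\<^esub> s2 \<odot>\<^bsub>A\<^esub> y"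
      using y by (simp add: A.smult_l_distr)
    then show ?case
      using A.submoduleE(5)[OF D sum.IH] by simp
  qed
  then have "ideal_smult R (ideal_pow R m (Suc t)) A \<subseteq> ?D"
    by (intro A.ideal_smult_minimal[OF D])
  then show ?case
    using Suc.prems(3) stable by auto
qed

end

section \<open>The two bounds for the length of the tensor product\<close>

theorem theorem3p8:
  fixes R :: "('r, 'x) ring_scheme" and m :: "'r set"
    and A :: "('r, 'a, 'c) module_scheme" and L :: "('r, 'l, 'd) module_scheme"
    and t :: nat
  assumes "noeth_local_ring R m"
    and "artinian_module R A"
    and "module R L" and "torsion_module R m L"
    and "ideal_smult R (ideal_pow R m t) A = ideal_smult R (ideal_pow R m (Suc t)) A"
  shows "mod_length R (tensor_module R A L)
           \<le> mod_length R (quot_module R A (ideal_smult R (ideal_pow R m t) A)) * beta0 R m L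
         \<and> mod_length R (tensor_module R A L)
           \<le> beta0 R m A * mod_length R (quot_module R L (ideal_smult R (ideal_pow R m t) L))"
proof -
  let ?P = "tensor_module R A L" and ?mt = "ideal_pow R m t"
  have m: "ideal m R"
    using assms(1) by (simp add: noeth_local_ring_def maximalideal.axioms)
  interpret T: module_pair R A L
    using assms(2,3) by (intro module_pair.intro) (simp_all add: artinian_module_def)
  interpret b: bilinear_span R A L ?P T.tensor
    by (rule T.tensor_bilinear_span)
  interpret b': bilinear_span R L A ?P "\<lambda>l a. T.tensor a l"
    by (rule b.flip)
  have mt: "?mt \<subseteq> carrier R"
    by (rule T.A.R.ideal_pow_subset[OF m])
  \<comment> \<open>The annihilating exponent \<open>n\<close> comes from torsion and depends on
    \<open>l\<close>; the vanishing holds for every \<open>n\<close>.\<close>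
  have vanish: "T.tensor x l = \<zero>\<^bsub>?P\<^esub>" if x: "x \<in> ideal_smult R ?mt A" and l: "l \<in> carrier L" for x l
  proof -
    obtain n where "\<And>a. a \<in> ideal_pow R m n \<Longrightarrow> a \<odot>\<^bsub>L\<^esub> l = \<zero>\<^bsub>L\<^esub>"
      using assms(4) l unfolding torsion_module_def by blast
    then show ?thesis
      using T.tensor_ideal_pow_eq_zero[OF m assms(5) l _ x] by blast
  qed
  have vanish': "T.tensor x l = \<zero>\<^bsub>?P\<^esub>" if l: "l \<in> ideal_smult R ?mt L" and x: "x \<in> carrier A" for x l
  proof -
    let ?D = "{l \<in> carrier L. \<forall>x\<in>carrier A. T.tensor x l = \<zero>\<^bsub>?P\<^esub>}"
    have "a \<odot>\<^bsub>L\<^esub> y \<in> ?D" if "a \<in> ?mt" "y \<in> carrier L" for a y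
    proof -
      have "a \<in> carrier R"
        using that mt by blast
      \<comment> \<open>The scalar \<open>a\<close> is carried over to \<open>x\<close>, which puts
        the first factor in \<open>m^t A\<close>, where \<open>vanish\<close> applies.\<close>
      moreover have "T.tensor x (a \<odot>\<^bsub>L\<^esub> y) = \<zero>\<^bsub>?P\<^esub>" if x: "x \<in> carrier A" for x
        using vanish[OF T.A.ideal_smult_mem[OF \<open>a \<in> ?mt\<close> x] \<open>y \<in> carrier L\<close>] x
          \<open>a \<in> carrier R\<close> \<open>y \<in> carrier L\<close> by (simp add: b.b_smult)
      ultimately show ?thesis
        using that by simp
    qed
    then have "ideal_smult R ?mt L \<subseteq> ?D"
      by (intro T.L.ideal_smult_minimal b.annihilator_submodule) auto
    then show ?thesis
      using l x by blast
  qed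
  have "mod_length R ?P \<le> mod_length R (quot_module R A (ideal_smult R ?mt A)) * beta0 R m L"
    by (rule b.mod_length_le_mult_beta0[where t = t, OF m T.A.ideal_smult_submodule[OF mt]])
      (simp_all add: T.A.ideal_smult_mem vanish)
  \<comment> \<open>The roles of \<open>A\<close> and \<open>L\<close> are exchanged by
    \<open>flip\<close>, with \<open>m^t L\<close> as the submodule killed by the pairing.\<close>
  moreover have "mod_length R ?P \<le> mod_length R (quot_module R L (ideal_smult R ?mt L)) * beta0 R m A"
    by (rule b'.mod_length_le_mult_beta0[where t = t, OF m T.L.ideal_smult_submodule[OF mt]])
      (simp_all add: T.L.ideal_smult_mem vanish')
  ultimately show ?thesis
    by (simp add: mult.commute)
qed

end
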